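(* Let $(\Omega,\Sigma,\mathbb{P})$ be a probability space and let $X$ be a Banach function space in $L_0(\Sigma)$ containing the constant functions. Let $f\in X$ with $f\ge0$, let $M=O_f=\operatorname{span}\{\mathbb 1,(f-k)^+:k\in\mathbb{R}\}$, and let $\pi$ be a positive linear functional on $M$. If $(M,\pi)$ admits no free lunches, then for every $g\in L_0(\sigma(f))\cap X$ the price of $g$ is determined by arbitrage from $(M,\pi)$.
   Context: $L_0(\Sigma)$ is the vector lattice of real-valued measurable functions modulo a.e. equality with the a.e. order. A Banach function space is an ideal $X$ of $L_0(\Sigma)$ (i.e. $|x|\le|y|$, $y\in X$ imply $x\in X$) endowed with a complete lattice norm. $X_+=\{x\in X:x\ge0\}$. A linear functional on $X$ is order continuous if $\phi(x_\alpha)\to0$ whenever $x_\alpha\to0$ in order (i.e. there is a net $z_\beta\downarrow0$ in $X$ such that for every $\beta$ eventually $|x_\alpha|\le z_\beta$); $X_n^\sim$ is the space of order continuous linear functionals, and $\sigma(X,X_n^\sim)$ is the weak topology induced by $X_n^\sim$. A functional is strictly positive if $\phi(x)>0$ for all $x\ge0$, $x\ne0$. $\sigma(f)$ is the smallest sub-$\sigma$-algebra making $f$ measurable and containing all null sets; $L_0(\sigma(f))$ the $\sigma(f)$-measurable elements of $L_0(\Sigma)$. Let $M_0=\{x\in M:\pi(x)=0\}$. $(M,\pi)$ admits no free lunches if $C\cap X_+=\{0\}$, where $C$ is the $\sigma(X,X_n^\sim)$-closure of $M_0-X_+$. A price $p\in\mathbb{R}$ of $g\in X$ is consistent with $(M,\pi)$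 if there exists a strictly positive $x^*\in X_n^\sim$ with $x^*|_M=\pi$ and $x^*(g)=p$. The price of $g$ is determined by arbitrage from $(M,\pi)$ if there is a single (i.e. exactly one) price $p$ for $g$ that is consistent with $(M,\pi)$. *)

theory Defs
  imports "HOL-Probability.Probability"
begin

text \<open>Elements of L_0 are represented by Borel measurable real functions on the
probability space P; all relations are taken almost everywhere (so every notion
below is invariant under a.e. equality).\<close>

definition ae_le :: "'a measure \<Rightarrow> ('a \<Rightarrow> real) \<Rightarrow> ('a \<Rightarrow> real) \<Rightarrow> bool" where
  "ae_le P x y \<longleftrightarrow> (AE \<omega> in P. x \<omega> \<le> y \<omega>)"

definition ae_eq :: "'a measure \<Rightarrow> ('a \<Rightarrow> real) \<Rightarrow> ('a \<Rightarrow> real) \<Rightarrow> bool" where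
  "ae_eq P x y \<longleftrightarrow> (AE \<omega> in P. x \<omega> = y \<omega>)"

definition ideal_L0 :: "'a measure \<Rightarrow> ('a \<Rightarrow> real) set \<Rightarrow> bool" where
  "ideal_L0 P X \<longleftrightarrow>
     X \<subseteq> borel_measurable P \<and> (\<lambda>_. 0) \<in> X \<and>
     (\<forall>x\<in>X. \<forall>y\<in>X. (\<lambda>\<omega>. x \<omega> + y \<omega>) \<in> X) \<and>
     (\<forall>c. \<forall>x\<in>X. (\<lambda>\<omega>. c * x \<omega>) \<in> X) \<and>
     (\<forall>x y. x \<in> borel_measurable P \<longrightarrow> y \<in> X \<longrightarrow>
        ae_le P (\<lambda>\<omega>. \<bar>x \<omega>\<bar>) (\<lambda>\<omega>. \<bar>y \<omega>\<bar>) \<longrightarrow> x \<in> X)"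

definition complete_lattice_norm ::
    "'a measure \<Rightarrow> ('a \<Rightarrow> real) set \<Rightarrow> (('a \<Rightarrow> real) \<Rightarrow> real) \<Rightarrow> bool" where
  "complete_lattice_norm P X N \<longleftrightarrow>
     (\<forall>x\<in>X. \<forall>y\<in>X. N (\<lambda>\<omega>. x \<omega> + y \<omega>) \<le> N x + N y) \<and>
     (\<forall>c. \<forall>x\<in>X. N (\<lambda>\<omega>. c * x \<omega>) = \<bar>c\<bar> * N x) \<and>
     (\<forall>x\<in>X. N x = 0 \<longleftrightarrow> ae_eq P x (\<lambda>_. 0)) \<and>
     (\<forall>x\<in>X. \<forall>y\<in>X. ae_le P (\<lambda>\<omega>. \<bar>x \<omega>\<bar>) (\<lambda>\<omega>. \<bar>y \<omega>\<bar>) \<longrightarrow> N x \<le> N y) \<and>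
     (\<forall>s :: nat \<Rightarrow> ('a \<Rightarrow> real). (\<forall>n. s n \<in> X) \<longrightarrow>
        (\<forall>e>0. \<exists>K. \<forall>m\<ge>K. \<forall>n\<ge>K. N (\<lambda>\<omega>. s m \<omega> - s n \<omega>) < e) \<longrightarrow>
        (\<exists>x\<in>X. (\<lambda>n. N (\<lambda>\<omega>. s n \<omega> - x \<omega>)) \<longlonglongrightarrow> 0))"

definition banach_function_space ::
    "'a measure \<Rightarrow> ('a \<Rightarrow> real) set \<Rightarrow> (('a \<Rightarrow> real) \<Rightarrow> real) \<Rightarrow> bool" where
  "banach_function_space P X N \<longleftrightarrow> ideal_L0 P X \<and> complete_lattice_norm P X N"

definition linear_functional ::
    "'a measure \<Rightarrow> ('a \<Rightarrow> real) set \<Rightarrow> (('a \<Rightarrow> real) \<Rightarrow> real) \<Rightarrow> bool" where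
  "linear_functional P X \<phi> \<longleftrightarrow>
     (\<forall>x\<in>X. \<forall>y\<in>X. \<phi> (\<lambda>\<omega>. x \<omega> + y \<omega>) = \<phi> x + \<phi> y) \<and>
     (\<forall>c. \<forall>x\<in>X. \<phi> (\<lambda>\<omega>. c * x \<omega>) = c * \<phi> x) \<and>
     (\<forall>x\<in>X. \<forall>y\<in>X. ae_eq P x y \<longrightarrow> \<phi> x = \<phi> y)"

text \<open>A net z_beta decreasing to 0 in X is represented by its set of values D:
a nonempty downward directed subset of X whose infimum in X is 0.\<close>
definition decr_to_zero :: "'a measure \<Rightarrow> ('a \<Rightarrow> real) set \<Rightarrow> ('a \<Rightarrow> real) set \<Rightarrow> bool" where
  "decr_to_zero P X D \<longleftrightarrow>
     D \<subseteq> X \<and> D \<noteq> {} \<and>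
     (\<forall>a\<in>D. \<forall>b\<in>D. \<exists>c\<in>D. ae_le P c a \<and> ae_le P c b) \<and>
     (\<forall>d\<in>D. ae_le P (\<lambda>_. 0) d) \<and>
     (\<forall>y\<in>X. (\<forall>d\<in>D. ae_le P y d) \<longrightarrow> ae_le P y (\<lambda>_. 0))"

text \<open>Order convergence to 0 of a net x in X (a net = a function with a proper filter
on its index set; here nets indexed by the type 'i).\<close>
definition order_conv_zero ::
    "'a measure \<Rightarrow> ('a \<Rightarrow> real) set \<Rightarrow> ('i \<Rightarrow> ('a \<Rightarrow> real)) \<Rightarrow> 'i filter \<Rightarrow> bool" where
  "order_conv_zero P X x F \<longleftrightarrow>
     (\<exists>D. decr_to_zero P X D \<and>
        (\<forall>z\<in>D. eventually (\<lambda>\<alpha>. ae_le P (\<lambda>\<omega>. \<bar>x \<alpha> \<omega>\<bar>) z) F))"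

text \<open>Order continuous linear functionals X_n^~ (nets indexed by the type of elements
of L_0, which suffices: any net can be reindexed by the set of dominating elements).\<close>
definition order_cont_dual ::
    "'a measure \<Rightarrow> ('a \<Rightarrow> real) set \<Rightarrow> (('a \<Rightarrow> real) \<Rightarrow> real) set" where
  "order_cont_dual P X = {\<phi>. linear_functional P X \<phi> \<and>
     (\<forall>(x :: ('a \<Rightarrow> real) \<Rightarrow> ('a \<Rightarrow> real)) F. F \<noteq> bot \<longrightarrow> (\<forall>\<alpha>. x \<alpha> \<in> X) \<longrightarrow>
        order_conv_zero P X x F \<longrightarrow> ((\<lambda>\<alpha>. \<phi> (x \<alpha>)) \<longlongrightarrow> 0) F)}"

definition weak_closure ::
    "'a measure \<Rightarrow> ('a \<Rightarrow> real) set \<Rightarrow> ('a \<Rightarrow> real) set \<Rightarrow> ('a \<Rightarrow> real) set" where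
  "weak_closure P X S = {x\<in>X. \<forall>\<Phi> e. finite \<Phi> \<longrightarrow> \<Phi> \<subseteq> order_cont_dual P X \<longrightarrow> e > 0 \<longrightarrow>
      (\<exists>s\<in>S. \<forall>\<phi>\<in>\<Phi>. \<bar>\<phi> x - \<phi> s\<bar> < e)}"

definition strictly_positive ::
    "'a measure \<Rightarrow> ('a \<Rightarrow> real) set \<Rightarrow> (('a \<Rightarrow> real) \<Rightarrow> real) \<Rightarrow> bool" where
  "strictly_positive P X \<phi> \<longleftrightarrow>
     (\<forall>x\<in>X. ae_le P (\<lambda>_. 0) x \<longrightarrow> \<not> ae_eq P x (\<lambda>_. 0) \<longrightarrow> \<phi> x > 0)"

definition option_space :: "('a \<Rightarrow> real) \<Rightarrow> ('a \<Rightarrow> real) set" where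
  "option_space f = {(\<lambda>\<omega>. c + (\<Sum>i<n. a i * max (f \<omega> - k i) 0)) | c n a k.
                       (c::real) \<in> UNIV \<and> (n::nat) \<in> UNIV \<and> (a :: nat \<Rightarrow> real) \<in> UNIV \<and>
                       (k :: nat \<Rightarrow> real) \<in> UNIV}"

definition positive_linear_on ::
    "'a measure \<Rightarrow> ('a \<Rightarrow> real) set \<Rightarrow> (('a \<Rightarrow> real) \<Rightarrow> real) \<Rightarrow> bool" where
  "positive_linear_on P M \<pi> \<longleftrightarrow>
     (\<forall>x\<in>M. \<forall>y\<in>M. \<pi> (\<lambda>\<omega>. x \<omega> + y \<omega>) = \<pi> x + \<pi> y) \<and>
     (\<forall>c. \<forall>x\<in>M. \<pi> (\<lambda>\<omega>. c * x \<omega>) = c * \<pi> x) \<and>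
     (\<forall>x\<in>M. ae_le P (\<lambda>_. 0) x \<longrightarrow> \<pi> x \<ge> 0)"

definition no_free_lunch ::
    "'a measure \<Rightarrow> ('a \<Rightarrow> real) set \<Rightarrow> ('a \<Rightarrow> real) set \<Rightarrow> (('a \<Rightarrow> real) \<Rightarrow> real) \<Rightarrow> bool" where
  "no_free_lunch P X M \<pi> \<longleftrightarrow>
     (let M0 = {m\<in>M. \<pi> m = 0};
          C = weak_closure P X {(\<lambda>\<omega>. m \<omega> - y \<omega>) | m y. m \<in> M0 \<and> y \<in> X \<and> ae_le P (\<lambda>_. 0) y}
      in \<forall>x\<in>C. ae_le P (\<lambda>_. 0) x \<longrightarrow> ae_eq P x (\<lambda>_. 0))"

definition consistent_price ::
    "'a measure \<Rightarrow> ('a \<Rightarrow> real) set \<Rightarrow> ('a \<Rightarrow> real) set \<Rightarrow> (('a \<Rightarrow> real) \<Rightarrow> real)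
       \<Rightarrow> ('a \<Rightarrow> real) \<Rightarrow> real \<Rightarrow> bool" where
  "consistent_price P X M \<pi> g p \<longleftrightarrow>
     (\<exists>\<phi>\<in>order_cont_dual P X. strictly_positive P X \<phi> \<and> (\<forall>m\<in>M. \<phi> m = \<pi> m) \<and> \<phi> g = p)"

definition price_determined_by_arbitrage ::
    "'a measure \<Rightarrow> ('a \<Rightarrow> real) set \<Rightarrow> ('a \<Rightarrow> real) set \<Rightarrow> (('a \<Rightarrow> real) \<Rightarrow> real)
       \<Rightarrow> ('a \<Rightarrow> real) \<Rightarrow> bool" where
  "price_determined_by_arbitrage P X M \<pi> g \<longleftrightarrow> (\<exists>!p. consistent_price P X M \<pi> g p)"

definition sigma_of :: "'a measure \<Rightarrow> ('a \<Rightarrow> real) \<Rightarrow> 'a measure" where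
  "sigma_of P f = sigma (space P)
     ({f -` B \<inter> space P | B. B \<in> sets borel} \<union> null_sets P)"

end

theory Submission
  imports Defs
begin

text \<open>Existence of a consistent price is a Kreps--Yan argument. By the absence of free lunches every
nonzero positive \<open>x\<close> lies outside the weak closure of the cone \<open>M\<^sub>0 - X\<^sub>+\<close>; a basic weak neighbourhood
involves finitely many functionals only, so a projection argument in finite dimension yields a positive
order continuous functional that vanishes on \<open>M\<^sub>0\<close> and is positive at \<open>x\<close>. Positive functionals on
the Banach lattice \<open>X\<close> are bounded, so countable weighted sums of them converge and stay order
continuous, and an exhaustion argument produces a single strictly positive one, which a positive
factor turns into an extension of \<open>\<pi>\<close>.

For uniqueness, call prices determine an order continuous positive functional on the indicators of
\<open>{f > k}\<close>, hence, by Dynkin's lemma and monotone approximation, on every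
\<open>\<sigma>(f)\<close>-measurable element of \<open>X\<close>.\<close>

section \<open>Separation of cones and exhaustion\<close>

text \<open>Separation takes place in the coordinates given by finitely many members of X_n^~, so
  the separating functional is a linear combination of them and order continuous by construction.
  The cone contains M_0, -M_0 and -X_+; being nonpositive on it therefore means vanishing on M_0 and
  being positive. The obstacle is uniformity: each functional depends on the positive element it was
  built for, and these elements are in general uncountable in number. Passing from elements to sets
  repairs this, since strict positivity can be tested on indicators and a set of maximal probability
  is reached by countably many steps. The weighted sum has to be order continuous along arbitrary
  nets. Its tail is controlled by the norm below one fixed element of a directed set, its head by
  finitely many order continuous functionals. The final factor is \<pi>(1)/\<phi>(1): M is the sum
  of M_0 and the constants, so vanishing on M_0 leaves only the value at 1 free. In the uniqueness
  part strict positivity makes both extensions monotone, and order continuity then acts as monotone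
  convergence.\<close>

lemma cone_separation:
  fixes S :: "('i \<Rightarrow> real) set" and b :: "'i \<Rightarrow> real"
  assumes fin: "finite I" and ne: "S \<noteq> {}"
    and add: "\<And>s t. s \<in> S \<Longrightarrow> t \<in> S \<Longrightarrow> (\<lambda>i. s i + t i) \<in> S"
    and scale: "\<And>c s. 0 \<le> c \<Longrightarrow> s \<in> S \<Longrightarrow> (\<lambda>i. c * s i) \<in> S"
    and "0 < e" and far: "\<And>s. s \<in> S \<Longrightarrow> \<exists>i\<in>I. e \<le> \<bar>b i - s i\<bar>"
  shows "\<exists>a. 0 < (\<Sum>i\<in>I. a i * b i) \<and> (\<forall>s\<in>S. (\<Sum>i\<in>I. a i * s i) \<le> 0)"
proof -
  define d where "d s = (\<Sum>i\<in>I. (b i - s i)\<^sup>2)" for s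
  define \<delta> where "\<delta> = Inf (d ` S)"
  have d_nonneg: "0 \<le> d s" for s
    unfolding d_def by (intro sum_nonneg) auto
  have d_ge: "e\<^sup>2 \<le> d s" if "s \<in> S" for s
  proof -
    obtain i where i: "i \<in> I" "e \<le> \<bar>b i - s i\<bar>" using far[OF \<open>s \<in> S\<close>] by blast
    have "e\<^sup>2 \<le> (b i - s i)\<^sup>2"
      using i \<open>0 < e\<close> by (metis abs_of_pos less_imp_le power2_abs power_mono)
    also have "\<dots> \<le> d s" unfolding d_def using i fin by (intro member_le_sum) auto
    finally show ?thesis .
  qed
  have bdd: "bdd_below (d ` S)" using d_nonneg by (intro bdd_belowI2[of _ 0]) auto
  have le_d: "\<delta> \<le> d s" if "s \<in> S" for s
    unfolding \<delta>_def using that bdd by (intro cInf_lower) auto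
  have "e\<^sup>2 \<le> \<delta>" unfolding \<delta>_def using ne d_ge by (intro cInf_greatest) auto
  then have "0 < \<delta>" using \<open>0 < e\<close> by (meson less_le_trans zero_less_power)
  have "\<exists>s\<in>S. d s < \<delta> + 1 / real (Suc n)" for n
  proof -
    have "Inf (d ` S) < \<delta> + 1 / real (Suc n)" unfolding \<delta>_def by simp
    then show ?thesis using cInf_lessD[of "d ` S"] ne by blast
  qed
  then obtain s where sS: "\<And>n. s n \<in> S" and s_less: "\<And>n. d (s n) < \<delta> + 1 / real (Suc n)"
    by metis
  have d_lim: "(\<lambda>n. d (s n)) \<longlonglongrightarrow> \<delta>"
  proof (rule tendsto_sandwich[of "\<lambda>_. \<delta>" _ _ "\<lambda>n. \<delta> + 1 / real (Suc n)"])
    have "(\<lambda>n. \<delta> + 1 / real (Suc n)) \<longlonglongrightarrow> \<delta> + 0"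
      by (intro tendsto_intros LIMSEQ_Suc lim_1_over_n)
    then show "(\<lambda>n. \<delta> + 1 / real (Suc n)) \<longlonglongrightarrow> \<delta>" by simp
  qed (use sS le_d s_less[THEN less_imp_le] in \<open>auto intro!: always_eventually\<close>)
  \<comment> \<open>The parallelogram law makes the minimizing sequence Cauchy.\<close>
  have parallelogram: "(\<Sum>i\<in>I. (s m i - s n i)\<^sup>2) \<le> 2 * (d (s m) - \<delta>) + 2 * (d (s n) - \<delta>)" for m n
  proof -
    \<comment> \<open>A convex cone contains midpoints, so the midpoint also has squared distance at
      least \<delta> from \<open>b\<close>.\<close>
    have mid: "(\<lambda>i. (1/2) * (s m i + s n i)) \<in> S"
      by (intro scale add sS) simp
    have "(\<Sum>i\<in>I. (s m i - s n i)\<^sup>2) =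
        2 * d (s m) + 2 * d (s n) - 4 * d (\<lambda>i. (1/2) * (s m i + s n i))"
      unfolding d_def sum_distrib_left sum.distrib[symmetric] sum_subtractf[symmetric]
      by (rule sum.cong) (auto simp: power2_eq_square field_simps)
    then show ?thesis using le_d[OF mid] by simp
  qed
  have "convergent (\<lambda>n. s n i)" if "i \<in> I" for i
  proof (rule Cauchy_convergent, rule CauchyI)
    fix r :: real assume "0 < r"
    then have "eventually (\<lambda>n. d (s n) < \<delta> + r\<^sup>2 / 4) sequentially"
      using d_lim by (intro order_tendstoD) auto
    then obtain K where K: "\<And>n. K \<le> n \<Longrightarrow> d (s n) < \<delta> + r\<^sup>2 / 4"
      by (auto simp: eventually_sequentially)
    have "norm (s m i - s n i) < r" if "K \<le> m" "K \<le> n" for m n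
    proof -
      have "(s m i - s n i)\<^sup>2 \<le> (\<Sum>i\<in>I. (s m i - s n i)\<^sup>2)"
        using fin \<open>i \<in> I\<close> by (intro member_le_sum) auto
      also have "\<dots> < r\<^sup>2" using parallelogram[of m n] K[OF that(1)] K[OF that(2)] by argo
      finally show ?thesis using \<open>0 < r\<close>
        by (metis abs_of_pos abs_le_square_iff linorder_not_le real_norm_def)
    qed
    then show "\<exists>K. \<forall>m\<ge>K. \<forall>n\<ge>K. norm (s m i - s n i) < r" by blast
  qed
  then obtain y where y: "\<And>i. i \<in> I \<Longrightarrow> (\<lambda>n. s n i) \<longlonglongrightarrow> y i"
    unfolding convergent_def by metis
  \<comment> \<open>\<open>y\<close> is the projection of \<open>b\<close> onto the closure of the
    cone and \<open>a\<close> the normal vector there. Since \<open>y\<close> may lie outside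
    \<open>S\<close>, the variations below are made at \<open>s n\<close> and passed to the
    limit.\<close>
  define a where "a i = b i - y i" for i
  have "(\<lambda>n. d (s n)) \<longlonglongrightarrow> (\<Sum>i\<in>I. (b i - y i)\<^sup>2)"
    unfolding d_def by (intro tendsto_intros y)
  then have a_sq: "(\<Sum>i\<in>I. a i * a i) = \<delta>"
    using d_lim LIMSEQ_unique unfolding a_def power2_eq_square by blast
  have nonpos: "(\<Sum>i\<in>I. a i * u i) \<le> 0" if u: "u \<in> S" for u
  proof (rule field_le_epsilon)
    fix r :: real assume "0 < r"
    define q where "q = (\<Sum>i\<in>I. (u i)\<^sup>2)"
    have "0 \<le> q" unfolding q_def by (intro sum_nonneg) auto
    \<comment> \<open>Minimality along direction \<open>u\<close> gives 2<a,u> \<le> t q. This step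
      length makes the right side at most \<open>r\<close>, also when \<open>q\<close> is 0.\<close>
    define t where "t = r / (q + 1)"
    have "0 < t" unfolding t_def using \<open>0 < r\<close> \<open>0 \<le> q\<close> by simp
    have "(\<lambda>n. d (\<lambda>i. s n i + t * u i)) \<longlonglongrightarrow> (\<Sum>i\<in>I. (b i - (y i + t * u i))\<^sup>2)"
      unfolding d_def by (intro tendsto_intros y)
    moreover have "\<delta> \<le> d (\<lambda>i. s n i + t * u i)" for n
      using \<open>0 < t\<close> by (intro le_d add sS scale u) simp
    ultimately have "\<delta> \<le> (\<Sum>i\<in>I. (b i - (y i + t * u i))\<^sup>2)"
      by (meson LIMSEQ_le_const)
    also have "\<dots> = (\<Sum>i\<in>I. a i * a i) - 2 * t * (\<Sum>i\<in>I. a i * u i) + t\<^sup>2 * q"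
      unfolding a_def q_def sum_distrib_left sum.distrib[symmetric] sum_subtractf[symmetric]
      by (rule sum.cong) (auto simp: power2_eq_square algebra_simps)
    finally have "2 * t * (\<Sum>i\<in>I. a i * u i) \<le> t * (t * q)"
      using a_sq by (simp add: power2_eq_square algebra_simps)
    then have "2 * (\<Sum>i\<in>I. a i * u i) \<le> t * q"
      using \<open>0 < t\<close> by (simp add: mult.assoc mult.left_commute)
    moreover have "t * q \<le> r"
      unfolding t_def using \<open>0 < r\<close> \<open>0 \<le> q\<close> by (simp add: field_simps)
    ultimately show "(\<Sum>i\<in>I. a i * u i) \<le> 0 + r" using \<open>0 < r\<close> by linarith
  qed
  have "0 \<le> (\<Sum>i\<in>I. a i * y i)"
  proof (rule field_le_epsilon)
    fix r :: real assume "0 < r"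
    define q where "q = (\<Sum>i\<in>I. (y i)\<^sup>2)"
    have "0 \<le> q" unfolding q_def by (intro sum_nonneg) auto
    \<comment> \<open>The variation now shrinks towards the apex; the cap 1 keeps the factor
      \<open>1 - t\<close> nonnegative, so the shrunk points stay in the cone.\<close>
    define t where "t = min 1 (r / (q + 1))"
    have t: "0 < t" "t \<le> 1" unfolding t_def using \<open>0 < r\<close> \<open>0 \<le> q\<close> by auto
    have "(\<lambda>n. d (\<lambda>i. (1 - t) * s n i)) \<longlonglongrightarrow> (\<Sum>i\<in>I. (b i - (1 - t) * y i)\<^sup>2)"
      unfolding d_def by (intro tendsto_intros y)
    moreover have "\<delta> \<le> d (\<lambda>i. (1 - t) * s n i)" for n
      using t by (intro le_d scale sS) simp
    ultimately have "\<delta> \<le> (\<Sum>i\<in>I. (b i - (1 - t) * y i)\<^sup>2)"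
      by (meson LIMSEQ_le_const)
    also have "\<dots> = (\<Sum>i\<in>I. a i * a i) + 2 * t * (\<Sum>i\<in>I. a i * y i) + t\<^sup>2 * q"
      unfolding a_def q_def sum_distrib_left sum.distrib[symmetric] sum_subtractf[symmetric]
      by (rule sum.cong) (auto simp: power2_eq_square algebra_simps)
    finally have "0 \<le> t * (2 * (\<Sum>i\<in>I. a i * y i) + t * q)"
      using a_sq by (simp add: power2_eq_square algebra_simps)
    then have "0 \<le> 2 * (\<Sum>i\<in>I. a i * y i) + t * q"
      using t by (simp add: zero_le_mult_iff)
    moreover have "t * q \<le> r / (q + 1) * q"
      unfolding t_def using \<open>0 \<le> q\<close> by (intro mult_right_mono) auto
    moreover have "r / (q + 1) * q \<le> r"
      using \<open>0 < r\<close> \<open>0 \<le> q\<close> by (simp add: field_simps)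
    ultimately show "0 \<le> (\<Sum>i\<in>I. a i * y i) + r" using \<open>0 < r\<close> by linarith
  qed
  moreover have "(\<Sum>i\<in>I. a i * b i) = (\<Sum>i\<in>I. a i * a i) + (\<Sum>i\<in>I. a i * y i)"
    unfolding sum.distrib[symmetric] by (rule sum.cong) (auto simp: a_def algebra_simps)
  ultimately have "0 < (\<Sum>i\<in>I. a i * b i)" using a_sq \<open>0 < \<delta>\<close> by linarith
  with nonpos show ?thesis by blast
qed

text \<open>A countable union of members whose measures approach the supremum attains it, so no
  further member can add mass. It is applied to the sets charged by an admissible functional and to
  the sets on which a single functional vanishes.\<close>

lemma (in finite_measure) exhaustion:
  assumes sub: "\<A> \<subseteq> sets M" and ne: "\<A> \<noteq> {}"
    and un: "\<And>A :: nat \<Rightarrow> 'a set. range A \<subseteq> \<A> \<Longrightarrow> (\<Union>i. A i) \<in> \<A>"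
  shows "\<exists>A\<in>\<A>. \<forall>B\<in>\<A>. measure M (B - A) = 0"
proof -
  define s where "s = Sup (measure M ` \<A>)"
  have bdd: "bdd_above (measure M ` \<A>)"
    by (intro bdd_aboveI2[of _ _ "measure M (space M)"] bounded_measure)
  have le_s: "measure M B \<le> s" if "B \<in> \<A>" for B
    unfolding s_def using that bdd by (intro cSup_upper) auto
  have "\<exists>A\<in>\<A>. s - 1 / real (Suc n) < measure M A" for n
  proof -
    have "s - 1 / real (Suc n) < Sup (measure M ` \<A>)" unfolding s_def by simp
    then show ?thesis using less_cSupD[of "measure M ` \<A>"] ne by blast
  qed
  then obtain A where A: "\<And>n. A n \<in> \<A>" "\<And>n. s - 1 / real (Suc n) < measure M (A n)"
    by metis
  let ?U = "\<Union>n. A n"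
  have U: "?U \<in> \<A>" using A by (intro un) auto
  have "s \<le> measure M ?U"
  proof (rule LIMSEQ_le_const2)
    have "(\<lambda>n. s - 1 / real (Suc n)) \<longlonglongrightarrow> s - 0"
      by (intro tendsto_intros LIMSEQ_Suc lim_1_over_n)
    then show "(\<lambda>n. s - 1 / real (Suc n)) \<longlonglongrightarrow> s" by simp
    have "measure M (A n) \<le> measure M ?U" for n
      using U sub by (intro finite_measure_mono) auto
    then show "\<exists>K. \<forall>n\<ge>K. s - 1 / real (Suc n) \<le> measure M ?U"
      using A(2) by (meson less_imp_le less_le_trans)
  qed
  moreover have "measure M ?U + measure M (B - ?U) \<le> s" if "B \<in> \<A>" for B
  proof -
    \<comment> \<open>The closure hypothesis concerns sequences, so the union of two sets is written
      as a union over a sequence with \<open>?U\<close> at index 0 and \<open>B\<close>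
      afterwards.\<close>
    have "(\<Union>n::nat. if n = 0 then ?U else B) \<in> \<A>"
      using U that by (intro un) auto
    also have "(\<Union>n::nat. if n = 0 then ?U else B) = ?U \<union> B"
      by (auto split: if_splits)
    finally have "measure M (?U \<union> B) \<le> s" by (rule le_s)
    moreover have "measure M (?U \<union> (B - ?U)) = measure M ?U + measure M (B - ?U)"
      using U that sub by (intro finite_measure_Union) auto
    ultimately show ?thesis by simp
  qed
  ultimately have "measure M (B - ?U) = 0" if "B \<in> \<A>" for B
    using that measure_nonneg[of M "B - ?U"] by (smt (verit))
  with U show ?thesis by blast
qed

section \<open>Positive order continuous functionals\<close>

definition pos_order_dual ::
    "'a measure \<Rightarrow> ('a \<Rightarrow> real) set \<Rightarrow> (('a \<Rightarrow> real) \<Rightarrow> real) set" where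
  "pos_order_dual P X = {\<phi> \<in> order_cont_dual P X. \<forall>x\<in>X. (AE \<omega> in P. 0 \<le> x \<omega>) \<longrightarrow> 0 \<le> \<phi> x}"

locale function_space_with_constants = prob_space P for P :: "'a measure" +
  fixes X :: "('a \<Rightarrow> real) set" and N :: "('a \<Rightarrow> real) \<Rightarrow> real"
  assumes bfs: "banach_function_space P X N"
    and const_mem: "(\<lambda>_. c) \<in> X"
begin

section \<open>The ideal X and its lattice norm\<close>

lemma measurable_mem: "x \<in> X \<Longrightarrow> x \<in> borel_measurable P"
  and add_mem: "x \<in> X \<Longrightarrow> y \<in> X \<Longrightarrow> (\<lambda>\<omega>. x \<omega> + y \<omega>) \<in> X"
  and scale_mem: "x \<in> X \<Longrightarrow> (\<lambda>\<omega>. c * x \<omega>) \<in> X"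
  and ideal_mem: "x \<in> borel_measurable P \<Longrightarrow> y \<in> X \<Longrightarrow> AE \<omega> in P. \<bar>x \<omega>\<bar> \<le> \<bar>y \<omega>\<bar> \<Longrightarrow> x \<in> X"
  using bfs by (auto simp: banach_function_space_def ideal_L0_def ae_le_def)

lemma diff_mem: "x \<in> X \<Longrightarrow> y \<in> X \<Longrightarrow> (\<lambda>\<omega>. x \<omega> - y \<omega>) \<in> X"
  using add_mem[of x "\<lambda>\<omega>. - 1 * y \<omega>"] scale_mem[of y "- 1"] by simp

lemma abs_mem: "x \<in> X \<Longrightarrow> (\<lambda>\<omega>. \<bar>x \<omega>\<bar>) \<in> X"
  by (rule ideal_mem[of _ x]) (auto dest: measurable_mem)

lemma max_zero_mem: "x \<in> X \<Longrightarrow> (\<lambda>\<omega>. max (x \<omega>) 0) \<in> X"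
  by (rule ideal_mem[of _ x]) (auto dest: measurable_mem)

lemma indicator_mem: "A \<in> sets P \<Longrightarrow> indicator A \<in> X"
  by (rule ideal_mem[of _ "\<lambda>_. 1"]) (auto intro: const_mem simp: indicator_def)

lemma sum_mem: "(\<And>i. i \<in> I \<Longrightarrow> x i \<in> X) \<Longrightarrow> (\<lambda>\<omega>. \<Sum>i\<in>I. x i \<omega>) \<in> X"
  by (induction I rule: infinite_finite_induct) (auto intro: const_mem add_mem)

lemma norm_add: "x \<in> X \<Longrightarrow> y \<in> X \<Longrightarrow> N (\<lambda>\<omega>. x \<omega> + y \<omega>) \<le> N x + N y"
  and norm_scale: "x \<in> X \<Longrightarrow> N (\<lambda>\<omega>. c * x \<omega>) = \<bar>c\<bar> * N x"
  and norm_eq_0_iff: "x \<in> X \<Longrightarrow> N x = 0 \<longleftrightarrow> (AE \<omega> in P. x \<omega> = 0)"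
  and norm_mono: "x \<in> X \<Longrightarrow> y \<in> X \<Longrightarrow> AE \<omega> in P. \<bar>x \<omega>\<bar> \<le> \<bar>y \<omega>\<bar> \<Longrightarrow> N x \<le> N y"
  and norm_complete: "(\<And>n::nat. s n \<in> X) \<Longrightarrow>
      (\<And>e. 0 < e \<Longrightarrow> \<exists>K. \<forall>m\<ge>K. \<forall>n\<ge>K. N (\<lambda>\<omega>. s m \<omega> - s n \<omega>) < e) \<Longrightarrow>
      \<exists>x\<in>X. (\<lambda>n. N (\<lambda>\<omega>. s n \<omega> - x \<omega>)) \<longlonglongrightarrow> 0"
  using bfs unfolding banach_function_space_def complete_lattice_norm_def ae_le_def ae_eq_def
  by blast+

lemma norm_nonneg: "x \<in> X \<Longrightarrow> 0 \<le> N x"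
  using norm_mono[of "\<lambda>_. 0" x] norm_eq_0_iff[of "\<lambda>_. 0"] const_mem[of 0] by auto

lemma norm_minus_commute: "x \<in> X \<Longrightarrow> y \<in> X \<Longrightarrow> N (\<lambda>\<omega>. x \<omega> - y \<omega>) = N (\<lambda>\<omega>. y \<omega> - x \<omega>)"
  by (intro antisym norm_mono diff_mem) (auto simp: abs_minus_commute)

section \<open>Linearity and order continuity of functionals\<close>

lemma functional_add: "\<phi> \<in> order_cont_dual P X \<Longrightarrow> x \<in> X \<Longrightarrow> y \<in> X \<Longrightarrow> \<phi> (\<lambda>\<omega>. x \<omega> + y \<omega>) = \<phi> x + \<phi> y"
  and functional_scale: "\<phi> \<in> order_cont_dual P X \<Longrightarrow> x \<in> X \<Longrightarrow> \<phi> (\<lambda>\<omega>. c * x \<omega>) = c * \<phi> x"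
  and functional_cong: "\<phi> \<in> order_cont_dual P X \<Longrightarrow> x \<in> X \<Longrightarrow> y \<in> X \<Longrightarrow> AE \<omega> in P. x \<omega> = y \<omega> \<Longrightarrow> \<phi> x = \<phi> y"
  unfolding order_cont_dual_def linear_functional_def ae_eq_def by blast+

lemma functional_diff:
  "\<phi> \<in> order_cont_dual P X \<Longrightarrow> x \<in> X \<Longrightarrow> y \<in> X \<Longrightarrow> \<phi> (\<lambda>\<omega>. x \<omega> - y \<omega>) = \<phi> x - \<phi> y"
  using functional_add[of \<phi> x "\<lambda>\<omega>. - 1 * y \<omega>"] functional_scale[of \<phi> y "- 1"] scale_mem[of y "- 1"]
  by simp

lemma functional_zero: "\<phi> \<in> order_cont_dual P X \<Longrightarrow> \<phi> (\<lambda>_. 0) = 0"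
  using functional_scale[of \<phi> "\<lambda>_. 0" 0] const_mem by simp

lemma functional_sum:
  assumes "\<phi> \<in> order_cont_dual P X" "\<And>i. i \<in> I \<Longrightarrow> x i \<in> X"
  shows "\<phi> (\<lambda>\<omega>. \<Sum>i\<in>I. x i \<omega>) = (\<Sum>i\<in>I. \<phi> (x i))"
  using assms(2)
  by (induction I rule: infinite_finite_induct)
    (auto simp: functional_zero[OF assms(1)] functional_add[OF assms(1)] sum_mem)

text \<open>Serves three purposes: the combination found by separation, the finite head of a series
  of functionals, and, with a one-point index set, multiplication by a constant.\<close>

lemma order_cont_dual_sum:
  assumes "\<And>i. i \<in> I \<Longrightarrow> \<phi> i \<in> order_cont_dual P X"
  shows "(\<lambda>x. \<Sum>i\<in>I. a i * \<phi> i x) \<in> order_cont_dual P X"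
proof -
  have "linear_functional P X (\<lambda>x. \<Sum>i\<in>I. a i * \<phi> i x)"
    unfolding linear_functional_def ae_eq_def
  proof (intro conjI ballI allI impI)
    fix x y assume xy: "x \<in> X" "y \<in> X"
    show "(\<Sum>i\<in>I. a i * \<phi> i (\<lambda>\<omega>. x \<omega> + y \<omega>)) = (\<Sum>i\<in>I. a i * \<phi> i x) + (\<Sum>i\<in>I. a i * \<phi> i y)"
      unfolding sum.distrib[symmetric]
      by (rule sum.cong) (auto simp: functional_add[OF assms xy] distrib_left)
    show "(\<Sum>i\<in>I. a i * \<phi> i x) = (\<Sum>i\<in>I. a i * \<phi> i y)" if "AE \<omega> in P. x \<omega> = y \<omega>"
      by (rule sum.cong) (auto simp: functional_cong[OF assms xy that])
  next
    fix c x assume x: "x \<in> X"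
    show "(\<Sum>i\<in>I. a i * \<phi> i (\<lambda>\<omega>. c * x \<omega>)) = c * (\<Sum>i\<in>I. a i * \<phi> i x)"
      unfolding sum_distrib_left
      by (rule sum.cong) (auto simp: functional_scale[OF assms x])
  qed
  moreover have "((\<lambda>\<alpha>. \<Sum>i\<in>I. a i * \<phi> i (x \<alpha>)) \<longlongrightarrow> 0) F"
    if "F \<noteq> bot" "\<forall>\<alpha>. x \<alpha> \<in> X" "order_conv_zero P X x F" for x :: "('a \<Rightarrow> real) \<Rightarrow> 'a \<Rightarrow> real" and F
  proof -
    have "((\<lambda>\<alpha>. \<Sum>i\<in>I. a i * \<phi> i (x \<alpha>)) \<longlongrightarrow> (\<Sum>i\<in>I. a i * 0)) F"
      using that assms by (intro tendsto_intros) (auto simp: order_cont_dual_def)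
    then show ?thesis by simp
  qed
  ultimately show ?thesis by (simp add: order_cont_dual_def)
qed

text \<open>The net-free form of order continuity in which it is used later;
  \<open>pos_order_dualI\<close> supplies the converse for positive functionals.\<close>

lemma order_cont_dual_decr:
  assumes \<phi>: "\<phi> \<in> order_cont_dual P X" and D: "decr_to_zero P X D" and "0 < e"
  shows "\<exists>z\<in>D. \<phi> z < e"
proof -
  \<comment> \<open>The directed set D is turned into a net indexed by itself.\<close>
  define F where "F = (INF d\<in>D. principal {z\<in>D. ae_le P z d})"
  \<comment> \<open>The net has to take values in X at every index of the type. The filter lives on
    \<open>D\<close>, so the default 0 outside \<open>D\<close> does not affect convergence.\<close>
  define x where "x z = (if z \<in> D then z else (\<lambda>_. 0))" for z :: "'a \<Rightarrow> real"
  have D': "D \<subseteq> X" "D \<noteq> {}" "\<And>a b. a \<in> D \<Longrightarrow> b \<in> D \<Longrightarrow> \<exists>c\<in>D. ae_le P c a \<and> ae_le P c b"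
    "\<And>d. d \<in> D \<Longrightarrow> AE \<omega> in P. 0 \<le> d \<omega>"
    using D unfolding decr_to_zero_def ae_le_def by auto
  have trans: "ae_le P a c" if "ae_le P a b" "ae_le P b c" for a b c
    using that unfolding ae_le_def by eventually_elim simp
  have refl: "ae_le P a a" for a by (simp add: ae_le_def)
  have ev: "eventually Q F \<longleftrightarrow> (\<exists>d\<in>D. \<forall>z\<in>D. ae_le P z d \<longrightarrow> Q z)" for Q
    unfolding F_def
  proof (subst eventually_INF_base)
    show "\<exists>c\<in>D. principal {z \<in> D. ae_le P z c} \<le>
        inf (principal {z \<in> D. ae_le P z a}) (principal {z \<in> D. ae_le P z b})"
      if "a \<in> D" "b \<in> D" for a b
    proof -
      obtain c where "c \<in> D" "ae_le P c a" "ae_le P c b" using D'(3) \<open>a \<in> D\<close> \<open>b \<in> D\<close> by blast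
      then show ?thesis using trans by (intro bexI[of _ c]) auto
    qed
  qed (use D' in \<open>auto simp: eventually_principal\<close>)
  have "F \<noteq> bot"
    using refl by (auto simp: trivial_limit_def ev)
  moreover have "\<forall>\<alpha>. x \<alpha> \<in> X" using D' const_mem by (auto simp: x_def)
  moreover have "order_conv_zero P X x F"
    unfolding order_conv_zero_def
  proof (intro exI[of _ D] conjI D ballI)
    fix d assume "d \<in> D"
    have "ae_le P (\<lambda>\<omega>. \<bar>x z \<omega>\<bar>) d" if "z \<in> D" "ae_le P z d" for z
      using D'(4)[OF that(1)] that unfolding ae_le_def x_def by auto
    then show "\<forall>\<^sub>F z in F. ae_le P (\<lambda>\<omega>. \<bar>x z \<omega>\<bar>) d"
      using \<open>d \<in> D\<close> unfolding ev by blast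
  qed
  ultimately have "((\<lambda>z. \<phi> (x z)) \<longlongrightarrow> 0) F"
    using \<phi> unfolding order_cont_dual_def by blast
  then have "eventually (\<lambda>z. \<phi> (x z) < e) F"
    using \<open>0 < e\<close> by (rule order_tendstoD)
  then obtain d where "d \<in> D" "\<phi> (x d) < e"
    unfolding ev using refl by blast
  then show ?thesis by (auto simp: x_def)
qed

section \<open>The positive cone of the order continuous dual\<close>

lemma pos_order_dual_order_cont: "\<phi> \<in> pos_order_dual P X \<Longrightarrow> \<phi> \<in> order_cont_dual P X"
  by (simp add: pos_order_dual_def)

lemma pos_order_dual_nonneg:
  "\<phi> \<in> pos_order_dual P X \<Longrightarrow> x \<in> X \<Longrightarrow> AE \<omega> in P. 0 \<le> x \<omega> \<Longrightarrow> 0 \<le> \<phi> x"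
  by (simp add: pos_order_dual_def)

lemma pos_order_dual_mono:
  assumes "\<phi> \<in> pos_order_dual P X" "x \<in> X" "y \<in> X" "AE \<omega> in P. x \<omega> \<le> y \<omega>"
  shows "\<phi> x \<le> \<phi> y"
  using pos_order_dual_nonneg[OF assms(1) diff_mem[OF assms(3,2)]] assms
  by (auto simp: functional_diff pos_order_dual_order_cont)

lemma pos_order_dual_abs_le:
  assumes \<phi>: "\<phi> \<in> pos_order_dual P X" and "x \<in> X" "y \<in> X" "AE \<omega> in P. \<bar>x \<omega>\<bar> \<le> y \<omega>"
  shows "\<bar>\<phi> x\<bar> \<le> \<phi> y"
proof -
  have "\<phi> x \<le> \<phi> y" using assms(4) by (intro pos_order_dual_mono[OF \<phi>] assms) auto
  moreover have "\<phi> (\<lambda>\<omega>. - 1 * x \<omega>) \<le> \<phi> y"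
    using assms(4) by (intro pos_order_dual_mono[OF \<phi>] assms scale_mem) auto
  moreover have "\<phi> (\<lambda>\<omega>. - 1 * x \<omega>) = - 1 * \<phi> x"
    using \<phi> \<open>x \<in> X\<close> by (intro functional_scale pos_order_dual_order_cont)
  ultimately show ?thesis by linarith
qed

text \<open>Positivity yields |\<phi> x| \<le> \<phi> z whenever |x| \<le> z, so a net eventually
  dominated by each member of a directed set is controlled by the values of \<phi> on that
  set.\<close>

lemma pos_order_dualI:
  assumes lin: "linear_functional P X \<phi>"
    and pos: "\<And>x. x \<in> X \<Longrightarrow> AE \<omega> in P. 0 \<le> x \<omega> \<Longrightarrow> 0 \<le> \<phi> x"
    and decr: "\<And>D e. decr_to_zero P X D \<Longrightarrow> 0 < e \<Longrightarrow> \<exists>z\<in>D. \<phi> z < e"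
  shows "\<phi> \<in> pos_order_dual P X"
proof -
  have le: "\<bar>\<phi> x\<bar> \<le> \<phi> y" if xy: "x \<in> X" "y \<in> X" "AE \<omega> in P. \<bar>x \<omega>\<bar> \<le> y \<omega>" for x y
  proof -
    have add: "\<phi> (\<lambda>\<omega>. y \<omega> + c * x \<omega>) = \<phi> y + c * \<phi> x" for c
      using lin xy scale_mem[of x c] unfolding linear_functional_def by metis
    \<comment> \<open>The signs c = 1 and c = -1 give the two halves of the estimate.\<close>
    have "0 \<le> \<phi> (\<lambda>\<omega>. y \<omega> + c * x \<omega>)" if "\<bar>c\<bar> = 1" for c
    proof (rule pos[OF add_mem[OF xy(2) scale_mem[OF xy(1)]]])
      show "AE \<omega> in P. 0 \<le> y \<omega> + c * x \<omega>"
        using xy(3) that by (auto simp: abs_if split: if_splits)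
    qed
    from this[of 1] this[of "- 1"] show ?thesis unfolding add by simp
  qed
  have "((\<lambda>\<alpha>. \<phi> (x \<alpha>)) \<longlongrightarrow> 0) F"
    if x: "\<forall>\<alpha>. x \<alpha> \<in> X" and conv: "order_conv_zero P X x F"
    for x :: "('a \<Rightarrow> real) \<Rightarrow> 'a \<Rightarrow> real" and F
  proof (rule tendstoI)
    fix e :: real assume "0 < e"
    obtain D where D: "decr_to_zero P X D"
      "\<And>z. z \<in> D \<Longrightarrow> eventually (\<lambda>\<alpha>. ae_le P (\<lambda>\<omega>. \<bar>x \<alpha> \<omega>\<bar>) z) F"
      using conv unfolding order_conv_zero_def by blast
    obtain z where z: "z \<in> D" "\<phi> z < e" using decr[OF D(1) \<open>0 < e\<close>] by blast
    have "z \<in> X" using z D(1) unfolding decr_to_zero_def by blast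
    show "eventually (\<lambda>\<alpha>. dist (\<phi> (x \<alpha>)) 0 < e) F"
      using D(2)[OF z(1)]
    proof eventually_elim
      case (elim \<alpha>)
      then have "\<bar>\<phi> (x \<alpha>)\<bar> \<le> \<phi> z" using x \<open>z \<in> X\<close> by (intro le) (auto simp: ae_le_def)
      with z show ?case by simp
    qed
  qed
  with lin pos show ?thesis by (simp add: pos_order_dual_def order_cont_dual_def)
qed

text \<open>The range of such a sequence is downward directed with infimum 0 in X, so order
  continuity applies to it; monotonicity of \<phi> carries smallness at one index to all later
  ones.\<close>

lemma pos_order_dual_decseq:
  assumes \<phi>: "\<phi> \<in> pos_order_dual P X" and x: "\<And>n::nat. x n \<in> X"
    and dec: "AE \<omega> in P. decseq (\<lambda>n. x n \<omega>)" and lim: "AE \<omega> in P. (\<lambda>n. x n \<omega>) \<longlonglongrightarrow> 0"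
  shows "(\<lambda>n. \<phi> (x n)) \<longlonglongrightarrow> 0"
proof -
  have mono: "AE \<omega> in P. x n \<omega> \<le> x m \<omega>" if "m \<le> n" for m n
    using dec that by (auto simp: decseq_def)
  have nonneg: "AE \<omega> in P. 0 \<le> x n \<omega>" for n
    using dec lim by eventually_elim (rule decseq_ge)
  have "decr_to_zero P X (range x)"
    unfolding decr_to_zero_def ae_le_def
  proof (intro conjI ballI impI)
    show "\<exists>c\<in>range x. (AE \<omega> in P. c \<omega> \<le> a \<omega>) \<and> (AE \<omega> in P. c \<omega> \<le> b \<omega>)"
      if ab: "a \<in> range x" "b \<in> range x" for a b
    proof -
      obtain m n where "a = x m" "b = x n" using ab by blast
      then show ?thesis
        using mono[of m "max m n"] mono[of n "max m n"] by auto
    qed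
    show "AE \<omega> in P. y \<omega> \<le> 0" if "\<forall>d\<in>range x. AE \<omega> in P. y \<omega> \<le> d \<omega>" for y
    proof -
      \<comment> \<open>Countability allows one exceptional null set for all indices; off it a lower
        bound lies below the pointwise limit.\<close>
      have "AE \<omega> in P. \<forall>n. y \<omega> \<le> x n \<omega>" using that by (subst AE_all_countable) auto
      then show ?thesis using lim by eventually_elim (auto intro: LIMSEQ_le_const)
    qed
  qed (use x nonneg in auto)
  note small = order_cont_dual_decr[OF pos_order_dual_order_cont[OF \<phi>] this]
  show ?thesis
  proof (rule LIMSEQ_I)
    fix r :: real assume "0 < r"
    then obtain K where K: "\<phi> (x K) < r" using small by blast
    have "norm (\<phi> (x n) - 0) < r" if "K \<le> n" for n
      using pos_order_dual_mono[OF \<phi> x x mono[OF that]] pos_order_dual_nonneg[OF \<phi> x nonneg] K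
      by (smt (verit) real_norm_def)
    then show "\<exists>K. \<forall>n\<ge>K. norm (\<phi> (x n) - 0) < r" by blast
  qed
qed

lemma pos_order_dual_incseq:
  assumes \<phi>: "\<phi> \<in> pos_order_dual P X" and x: "\<And>n::nat. x n \<in> X" and y: "y \<in> X"
    and inc: "AE \<omega> in P. incseq (\<lambda>n. x n \<omega>)" and lim: "AE \<omega> in P. (\<lambda>n. x n \<omega>) \<longlonglongrightarrow> y \<omega>"
  shows "(\<lambda>n. \<phi> (x n)) \<longlonglongrightarrow> \<phi> y"
proof -
  have "(\<lambda>n. \<phi> (\<lambda>\<omega>. y \<omega> - x n \<omega>)) \<longlonglongrightarrow> 0"
  proof (rule pos_order_dual_decseq[OF \<phi> diff_mem[OF y x]])
    show "AE \<omega> in P. decseq (\<lambda>n. y \<omega> - x n \<omega>)"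
      using inc by eventually_elim (auto simp: decseq_def incseq_def)
    show "AE \<omega> in P. (\<lambda>n. y \<omega> - x n \<omega>) \<longlonglongrightarrow> 0"
      using lim by eventually_elim (auto intro!: tendsto_eq_intros)
  qed
  then have "(\<lambda>n. \<phi> y - (\<phi> y - \<phi> (x n))) \<longlonglongrightarrow> \<phi> y - 0"
    unfolding functional_diff[OF pos_order_dual_order_cont[OF \<phi>] y x] by (intro tendsto_intros)
  then show ?thesis by simp
qed

text \<open>If \<phi> were unbounded, suitably normalized nonnegative elements \<open>y n\<close>
  would have summable norms but values at least 2^n. Completeness provides a sum in X that dominates
  all of them, and \<phi> would have no finite value there.\<close>

lemma pos_order_dual_bounded:
  assumes \<phi>: "\<phi> \<in> pos_order_dual P X"
  shows "\<exists>C\<ge>0. \<forall>x\<in>X. \<bar>\<phi> x\<bar> \<le> C * N x"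
proof (rule ccontr)
  assume "\<not> ?thesis"
  \<comment> \<open>The factor 4^n splits into two factors 2^n: one makes the norms of the
    \<open>y n\<close> summable, the other makes their values grow.\<close>
  then have "\<exists>x\<in>X. 4 ^ n * N x < \<bar>\<phi> x\<bar>" for n :: nat
    by (meson linorder_not_le zero_le_numeral zero_le_power)
  then obtain x where x: "\<And>n. x n \<in> X" and x_less: "\<And>n::nat. 4 ^ n * N (x n) < \<bar>\<phi> (x n)\<bar>"
    by metis
  note \<phi>' = pos_order_dual_order_cont[OF \<phi>]
  have Npos: "0 < N (x n)" for n
  proof -
    have "N (x n) \<noteq> 0"
    proof
      assume "N (x n) = 0"
      then have "\<phi> (x n) = \<phi> (\<lambda>_. 0)"
        using x const_mem by (intro functional_cong[OF \<phi>']) (auto simp: norm_eq_0_iff)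
      then show False using x_less[of n] \<open>N (x n) = 0\<close> functional_zero[OF \<phi>'] by simp
    qed
    with norm_nonneg[OF x[of n]] show ?thesis by simp
  qed
  define y where "y n \<omega> = 1 / (2 ^ n * N (x n)) * \<bar>x n \<omega>\<bar>" for n \<omega>
  have y: "y n \<in> X" for n unfolding y_def by (intro scale_mem abs_mem x)
  have y_nonneg: "0 \<le> y n \<omega>" for n \<omega> unfolding y_def using Npos[of n] by simp
  have N_abs: "N (\<lambda>\<omega>. \<bar>x n \<omega>\<bar>) = N (x n)" for n
    by (intro antisym norm_mono abs_mem x) auto
  have N_y: "N (y n) = 1 / 2 ^ n" for n
    unfolding y_def using Npos[of n] by (subst norm_scale[OF abs_mem[OF x]]) (simp add: N_abs)
  have \<phi>_y: "2 ^ n \<le> \<phi> (y n)" for n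
  proof -
    have "2 ^ n * (2 ^ n * N (x n)) = 4 ^ n * N (x n)"
      by (simp flip: power_mult_distrib mult.assoc)
    also have "\<dots> \<le> \<phi> (\<lambda>\<omega>. \<bar>x n \<omega>\<bar>)"
      using x_less[of n] pos_order_dual_abs_le[OF \<phi> x abs_mem[OF x], of n n] by simp
    finally show ?thesis
      unfolding y_def functional_scale[OF \<phi>' abs_mem[OF x]] using Npos[of n]
      by (simp add: field_simps)
  qed
  define s where "s n \<omega> = (\<Sum>k<n. y k \<omega>)" for n \<omega>
  have s: "s n \<in> X" for n unfolding s_def by (intro sum_mem y)
  \<comment> \<open>The right side is the exact geometric sum of 1/2^j for j from n to n + k - 1;
    the subtracted term is what lets the induction close.\<close>
  have tail: "N (\<lambda>\<omega>. s (n + k) \<omega> - s n \<omega>) \<le> 2 / 2 ^ n - 2 / 2 ^ (n + k)" for n k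
  proof (induction k)
    case 0
    then show ?case using norm_eq_0_iff[OF const_mem, of 0] by simp
  next
    case (Suc k)
    have "(\<lambda>\<omega>. s (n + Suc k) \<omega> - s n \<omega>) = (\<lambda>\<omega>. (s (n + k) \<omega> - s n \<omega>) + y (n + k) \<omega>)"
      by (simp add: s_def fun_eq_iff)
    then have "N (\<lambda>\<omega>. s (n + Suc k) \<omega> - s n \<omega>) \<le> N (\<lambda>\<omega>. s (n + k) \<omega> - s n \<omega>) + N (y (n + k))"
      using norm_add[OF diff_mem[OF s s] y] by simp
    also have "\<dots> \<le> 2 / 2 ^ n - 2 / 2 ^ (n + Suc k)"
      using Suc N_y[of "n + k"] by simp
    finally show ?case .
  qed
  have tail': "N (\<lambda>\<omega>. s m \<omega> - s n \<omega>) \<le> 2 / 2 ^ K" if "K \<le> m" "K \<le> n" for m n K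
  proof -
    have *: "N (\<lambda>\<omega>. s m \<omega> - s n \<omega>) \<le> 2 / 2 ^ K" if "K \<le> n" "n \<le> m" for m n
    proof -
      have "N (\<lambda>\<omega>. s m \<omega> - s n \<omega>) \<le> 2 / 2 ^ n - 2 / 2 ^ m"
        using tail[of n "m - n"] that by simp
      also have "\<dots> \<le> 2 / 2 ^ n" by simp
      also have "\<dots> \<le> 2 / 2 ^ K"
        using that by (intro divide_left_mono power_increasing) auto
      finally show ?thesis .
    qed
    show ?thesis
      using *[of m n] *[of n m] that norm_minus_commute[OF s s, of m n] by (cases "n \<le> m") auto
  qed
  have "\<exists>z\<in>X. (\<lambda>n. N (\<lambda>\<omega>. s n \<omega> - z \<omega>)) \<longlonglongrightarrow> 0"
  proof (rule norm_complete[OF s])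
    fix e :: real assume "0 < e"
    then obtain K where "(1/2) ^ K < e / 2" using real_arch_pow_inv[of "e / 2" "1 / 2"] by auto
    then have "2 / 2 ^ K < e" by (simp add: power_one_over field_simps)
    then show "\<exists>K. \<forall>m\<ge>K. \<forall>n\<ge>K. N (\<lambda>\<omega>. s m \<omega> - s n \<omega>) < e"
      using tail' by (meson le_less_trans)
  qed
  then obtain z where z: "z \<in> X" and z_lim: "(\<lambda>n. N (\<lambda>\<omega>. s n \<omega> - z \<omega>)) \<longlonglongrightarrow> 0" by blast
  \<comment> \<open>Norm convergence is turned into an a.e. bound: partial sums increase, so for n
    \<ge> m the positive part of s_m - z is at most |s_n - z|. Its norm is therefore 0.\<close>
  have s_le: "AE \<omega> in P. s m \<omega> \<le> z \<omega>" for m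
  proof -
    let ?p = "\<lambda>\<omega>. max (s m \<omega> - z \<omega>) 0"
    have p: "?p \<in> X" by (intro max_zero_mem diff_mem s z)
    have "N ?p \<le> N (\<lambda>\<omega>. s n \<omega> - z \<omega>)" if "m \<le> n" for n
    proof (intro norm_mono p diff_mem s z AE_I2)
      fix \<omega>
      have "s m \<omega> \<le> s n \<omega>" unfolding s_def using that y_nonneg by (intro sum_mono2) auto
      then show "\<bar>?p \<omega>\<bar> \<le> \<bar>s n \<omega> - z \<omega>\<bar>" by auto
    qed
    then have "N ?p \<le> 0" using LIMSEQ_le_const[OF z_lim] by blast
    then have "N ?p = 0" using norm_nonneg[OF p] by simp
    then have "AE \<omega> in P. ?p \<omega> = 0" using norm_eq_0_iff[OF p] by blast
    then show ?thesis by eventually_elim (simp add: max_def split: if_splits)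
  qed
  have "2 ^ n \<le> \<phi> z" for n
  proof -
    have "AE \<omega> in P. y n \<omega> \<le> z \<omega>"
      using s_le[of "Suc n"]
    proof eventually_elim
      case (elim \<omega>)
      have "y n \<omega> \<le> s (Suc n) \<omega>" unfolding s_def using y_nonneg by (intro member_le_sum) auto
      with elim show ?case by simp
    qed
    then have "\<phi> (y n) \<le> \<phi> z" by (intro pos_order_dual_mono[OF \<phi>] y z)
    with \<phi>_y[of n] show ?thesis by simp
  qed
  moreover obtain n where "\<phi> z < 2 ^ n" using real_arch_pow[of 2 "\<phi> z"] by auto
  ultimately show False by (meson linorder_not_le)
qed

text \<open>Norm bounds give weights for which the series converges at every point of X. Order
  continuity follows by splitting the series: the tail is small uniformly below a fixed element of
  the directed set, the head is a finite combination.\<close>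

lemma pos_order_dual_countable_sum:
  assumes \<phi>: "\<And>n::nat. \<phi> n \<in> pos_order_dual P X"
  obtains c where "\<And>n. 0 < c n" "\<And>x. x \<in> X \<Longrightarrow> summable (\<lambda>n. c n * \<phi> n x)"
    "(\<lambda>x. \<Sum>n. c n * \<phi> n x) \<in> pos_order_dual P X"
proof -
  obtain C where C: "\<And>n. 0 \<le> C n" "\<And>n x. x \<in> X \<Longrightarrow> \<bar>\<phi> n x\<bar> \<le> C n * N x"
    using pos_order_dual_bounded[OF \<phi>] by metis
  \<comment> \<open>The bound \<open>C n\<close> may be 0; adding 1 keeps the weight well defined
    and positive.\<close>
  define c where "c n = (1/2) ^ n / (1 + C n)" for n
  have c_pos: "0 < c n" for n unfolding c_def using C(1)[of n] by simp
  note \<phi>' = pos_order_dual_order_cont[OF \<phi>]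
  have bound: "\<bar>c n * \<phi> n x\<bar> \<le> (1/2) ^ n * N x" if "x \<in> X" for n x
  proof -
    have "\<bar>c n * \<phi> n x\<bar> = c n * \<bar>\<phi> n x\<bar>" using c_pos[of n] by (simp add: abs_mult)
    also have "\<dots> \<le> c n * ((1 + C n) * N x)"
      using C(2)[OF that, of n] norm_nonneg[OF that] c_pos[of n]
      by (intro mult_left_mono) (auto simp: algebra_simps)
    also have "\<dots> = (1/2) ^ n * N x" unfolding c_def using C(1)[of n] by simp
    finally show ?thesis .
  qed
  have geo: "summable (\<lambda>n. (1/2) ^ n * N x)" for x
    by (intro summable_mult2 summable_geometric) simp
  have summ: "summable (\<lambda>n. c n * \<phi> n x)" if "x \<in> X" for x
    using bound[OF that] by (intro summable_comparison_test'[OF geo]) simp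
  have "(\<lambda>x. \<Sum>n. c n * \<phi> n x) \<in> pos_order_dual P X"
  proof (rule pos_order_dualI)
    show "linear_functional P X (\<lambda>x. \<Sum>n. c n * \<phi> n x)"
      unfolding linear_functional_def ae_eq_def
    proof (intro conjI ballI allI impI)
      fix x y assume xy: "x \<in> X" "y \<in> X"
      show "(\<Sum>n. c n * \<phi> n (\<lambda>\<omega>. x \<omega> + y \<omega>)) = (\<Sum>n. c n * \<phi> n x) + (\<Sum>n. c n * \<phi> n y)"
        using suminf_add[OF summ[OF xy(1)] summ[OF xy(2)]]
        by (simp add: functional_add[OF \<phi>' xy] algebra_simps)
      show "(\<Sum>n. c n * \<phi> n x) = (\<Sum>n. c n * \<phi> n y)" if "AE \<omega> in P. x \<omega> = y \<omega>"
        using functional_cong[OF \<phi>' xy that] by simp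
    next
      fix a x assume x: "x \<in> X"
      show "(\<Sum>n. c n * \<phi> n (\<lambda>\<omega>. a * x \<omega>)) = a * (\<Sum>n. c n * \<phi> n x)"
        using suminf_mult[OF summ[OF x], of a]
        by (simp add: functional_scale[OF \<phi>' x] mult.left_commute)
    qed
    show "0 \<le> (\<Sum>n. c n * \<phi> n x)" if "x \<in> X" "AE \<omega> in P. 0 \<le> x \<omega>" for x
      using that c_pos[THEN less_imp_le] by (intro suminf_nonneg summ mult_nonneg_nonneg pos_order_dual_nonneg[OF \<phi>])
    fix D and e :: real assume D: "decr_to_zero P X D" and "0 < e"
    have D': "D \<subseteq> X" "D \<noteq> {}" "\<And>a b. a \<in> D \<Longrightarrow> b \<in> D \<Longrightarrow> \<exists>c\<in>D. ae_le P c a \<and> ae_le P c b"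
      "\<And>d. d \<in> D \<Longrightarrow> AE \<omega> in P. 0 \<le> d \<omega>"
      using D unfolding decr_to_zero_def ae_le_def by auto
    obtain d where d: "d \<in> D" using D'(2) by blast
    \<comment> \<open>The cut \<open>K\<close> depends on \<open>d\<close> alone, because every
      nonnegative z below \<open>d\<close> has N z \<le> N d. Hence \<open>z0\<close> may be chosen
      after \<open>K\<close>, and a common lower bound of \<open>z0\<close> and \<open>d\<close>
      handles head and tail together.\<close>
    obtain K where "norm (\<Sum>n. (1/2) ^ (n + K) * N d) < e / 2"
      using suminf_exist_split[of "e / 2", OF _ geo] \<open>0 < e\<close> by (metis half_gt_zero order_refl)
    then have K: "(\<Sum>n. (1/2) ^ (n + K) * N d) < e / 2" by simp
    obtain z0 where z0: "z0 \<in> D" "(\<Sum>n<K. c n * \<phi> n z0) < e / 2"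
      using order_cont_dual_decr[OF order_cont_dual_sum[of "{..<K}" \<phi> c] D, of "e / 2"] \<phi>' \<open>0 < e\<close> by auto
    obtain z where z: "z \<in> D" "ae_le P z z0" "ae_le P z d" using D'(3)[OF z0(1) d] by blast
    have X: "z \<in> X" "z0 \<in> X" "d \<in> X" using z z0 d D'(1) by auto
    have "(\<Sum>n. c n * \<phi> n z) = (\<Sum>n. c (n + K) * \<phi> (n + K) z) + (\<Sum>n<K. c n * \<phi> n z)"
      by (rule suminf_split_initial_segment[OF summ[OF X(1)]])
    also have "(\<Sum>n<K. c n * \<phi> n z) \<le> (\<Sum>n<K. c n * \<phi> n z0)"
      using z X c_pos[THEN less_imp_le]
      by (intro sum_mono mult_left_mono pos_order_dual_mono[OF \<phi>]) (auto simp: ae_le_def)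
    also have "(\<Sum>n. c (n + K) * \<phi> (n + K) z) \<le> (\<Sum>n. (1/2) ^ (n + K) * N d)"
    proof (rule suminf_le)
      have "N z \<le> N d" using z D'(4)[OF z(1)] X by (intro norm_mono) (auto simp: ae_le_def)
      then show "c (n + K) * \<phi> (n + K) z \<le> (1/2) ^ (n + K) * N d" for n
        using bound[OF X(1), of "n + K"]
        by (smt (verit) mult_left_mono zero_le_power zero_le_divide_1_iff)
      show "summable (\<lambda>n. c (n + K) * \<phi> (n + K) z)"
        using summable_ignore_initial_segment[OF summ[OF X(1)]] .
      show "summable (\<lambda>n. (1/2) ^ (n + K) * N d)"
        using summable_ignore_initial_segment[OF geo] .
    qed
    finally have "(\<Sum>n. c n * \<phi> n z) < e" using K z0 by simp
    with z show "\<exists>z\<in>D. (\<Sum>n. c n * \<phi> n z) < e" by blast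
  qed
  with c_pos summ show thesis by (intro that)
qed

section \<open>Positive functionals as set functions\<close>

lemma pos_order_dual_indicator_mono:
  assumes "\<phi> \<in> pos_order_dual P X" "A \<in> sets P" "B \<in> sets P" "A \<subseteq> B"
  shows "\<phi> (indicator A) \<le> \<phi> (indicator B)"
  using assms by (intro pos_order_dual_mono[OF assms(1)] indicator_mem AE_I2) (auto simp: indicator_def)

lemma pos_order_dual_indicator_Un:
  assumes \<phi>: "\<phi> \<in> pos_order_dual P X" and AB: "A \<in> sets P" "B \<in> sets P"
  shows "\<phi> (indicator (A \<union> B)) \<le> \<phi> (indicator A) + \<phi> (indicator B)"
proof -
  have "\<phi> (indicator (A \<union> B)) \<le> \<phi> (\<lambda>\<omega>. indicator A \<omega> + indicator B \<omega>)"
    using AB by (intro pos_order_dual_mono[OF \<phi>] indicator_mem add_mem AE_I2) (auto simp: indicator_def)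
  then show ?thesis
    using AB by (simp add: functional_add[OF pos_order_dual_order_cont[OF \<phi>]] indicator_mem)
qed

lemma pos_order_dual_indicator_incseq:
  assumes \<phi>: "\<phi> \<in> pos_order_dual P X" and A: "\<And>n::nat. A n \<in> sets P" "incseq A"
  shows "(\<lambda>n. \<phi> (indicator (A n))) \<longlonglongrightarrow> \<phi> (indicator (\<Union>n. A n))"
proof (rule pos_order_dual_incseq[OF \<phi>])
  show "AE \<omega> in P. incseq (\<lambda>n. indicator (A n) \<omega> :: real)"
    using A(2) by (intro AE_I2) (auto simp: incseq_def indicator_def)
  show "AE \<omega> in P. (\<lambda>n. indicator (A n) \<omega> :: real) \<longlonglongrightarrow> indicator (\<Union>n. A n) \<omega>"
    using LIMSEQ_indicator_incseq[OF A(2)] by auto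
qed (use A in \<open>auto intro!: indicator_mem\<close>)

lemma pos_order_dual_null_set:
  assumes "\<phi> \<in> pos_order_dual P X" "A \<in> sets P" "prob A = 0"
  shows "\<phi> (indicator A) = 0"
proof -
  have "A \<in> null_sets P" using assms by (simp add: null_sets_def emeasure_eq_measure)
  then have "AE \<omega> in P. (indicator A \<omega> :: real) = 0"
    by (rule AE_I'[of A]) (auto simp: indicator_def)
  then have "\<phi> (indicator A) = \<phi> (\<lambda>_. 0)"
    using assms
    by (intro functional_cong[OF pos_order_dual_order_cont[OF assms(1)]] indicator_mem const_mem)
  then show ?thesis using functional_zero pos_order_dual_order_cont assms(1) by simp
qed

text \<open>Subadditivity handles finite unions, and order continuity passes to the limit. This is
  the closure condition for exhausting the null sets of a functional.\<close>

lemma pos_order_dual_null_UN: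
  assumes \<phi>: "\<phi> \<in> pos_order_dual P X"
    and Z: "\<And>n::nat. Z n \<in> sets P" "\<And>n. \<phi> (indicator (Z n)) = 0"
  shows "\<phi> (indicator (\<Union>n. Z n)) = 0"
proof -
  have fin: "\<phi> (indicator (\<Union>i<n. Z i)) = 0" for n
  proof (induction n)
    case 0
    then show ?case using functional_zero[OF pos_order_dual_order_cont[OF \<phi>]] by simp
  next
    case (Suc n)
    have "\<phi> (indicator ((\<Union>i<n. Z i) \<union> Z n)) \<le> 0"
      using pos_order_dual_indicator_Un[OF \<phi>, of "\<Union>i<n. Z i" "Z n"] Suc Z by auto
    moreover have "0 \<le> \<phi> (indicator ((\<Union>i<n. Z i) \<union> Z n))"
      using Z by (intro pos_order_dual_nonneg[OF \<phi>] indicator_mem AE_I2) auto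
    ultimately show ?case by (simp add: lessThan_Suc Un_commute)
  qed
  have "(\<lambda>n. \<phi> (indicator (\<Union>i<n. Z i))) \<longlonglongrightarrow> \<phi> (indicator (\<Union>n. \<Union>i<n. Z i))"
    using Z by (intro pos_order_dual_indicator_incseq[OF \<phi>]) (auto simp: incseq_def intro: less_le_trans)
  moreover have "(\<Union>n. \<Union>i<n. Z i) = (\<Union>n. Z n)" by blast
  ultimately have "(\<lambda>n. 0) \<longlonglongrightarrow> \<phi> (indicator (\<Union>n. Z n))" unfolding fin by simp
  then show ?thesis using LIMSEQ_unique tendsto_const by blast
qed

text \<open>A nonnegative element that is not a.e. zero exceeds some 1/(n+1) on a set of positive
  probability, so its value is at least a positive multiple of the value of that indicator.\<close>

lemma strictly_positiveI:
  assumes \<phi>: "\<phi> \<in> pos_order_dual P X"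
    and pos: "\<And>B. B \<in> sets P \<Longrightarrow> 0 < prob B \<Longrightarrow> 0 < \<phi> (indicator B)"
  shows "strictly_positive P X \<phi>"
  unfolding strictly_positive_def ae_le_def ae_eq_def
proof (intro ballI impI)
  fix x assume x: "x \<in> X" "AE \<omega> in P. 0 \<le> x \<omega>" "\<not> (AE \<omega> in P. x \<omega> = 0)"
  note [measurable] = measurable_mem[OF x(1)]
  define B where "B n = {\<omega> \<in> space P. 1 / real (Suc n) < x \<omega>}" for n
  have B[measurable]: "B n \<in> sets P" for n unfolding B_def by measurable
  have "\<exists>n. 0 < prob (B n)"
  proof (rule ccontr)
    assume "\<not> ?thesis"
    then have "prob (B n) = 0" for n by (simp add: not_less measure_le_0_iff)
    then have "B n \<in> null_sets P" for n using B by (simp add: null_sets_def emeasure_eq_measure)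
    then have "AE \<omega> in P. \<forall>n. \<omega> \<notin> B n" by (subst AE_all_countable) (auto intro: AE_not_in)
    then have "AE \<omega> in P. x \<omega> = 0"
      using x(2) AE_space
    proof eventually_elim
      case (elim \<omega>)
      then have le: "x \<omega> \<le> 1 / real (Suc n)" for n unfolding B_def by (simp add: not_less)
      have "x \<omega> \<le> 0"
      proof (rule ccontr)
        assume "\<not> x \<omega> \<le> 0"
        then obtain n where "1 / real (Suc n) < x \<omega>" using nat_approx_posE[of "x \<omega>"] by auto
        with le[of n] show False by simp
      qed
      with elim show ?case by simp
    qed
    with x(3) show False by blast
  qed
  then obtain n where n: "0 < prob (B n)" by blast
  have "0 < 1 / real (Suc n) * \<phi> (indicator (B n))" using pos[OF B n] by simp
  also have "\<dots> = \<phi> (\<lambda>\<omega>. 1 / real (Suc n) * indicator (B n) \<omega>)"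
    by (rule functional_scale[OF pos_order_dual_order_cont[OF \<phi>] indicator_mem[OF B], symmetric])
  also have "\<dots> \<le> \<phi> x"
  proof (intro pos_order_dual_mono[OF \<phi>] scale_mem indicator_mem B x(1))
    show "AE \<omega> in P. 1 / real (Suc n) * indicator (B n) \<omega> \<le> x \<omega>"
      using x(2) by eventually_elim (auto simp: B_def indicator_def)
  qed
  finally show "0 < \<phi> x" .
qed

text \<open>Strict positivity says nothing about elements that are a.e. zero; there invariance under
  a.e. equality gives the value 0.\<close>

lemma pos_order_dual_strictly_positive:
  assumes "\<phi> \<in> order_cont_dual P X" "strictly_positive P X \<phi>"
  shows "\<phi> \<in> pos_order_dual P X"
proof -
  have "0 \<le> \<phi> x" if "x \<in> X" "AE \<omega> in P. 0 \<le> x \<omega>" for x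
  proof (cases "AE \<omega> in P. x \<omega> = 0")
    case True
    then show ?thesis
      using functional_cong[OF assms(1) that(1) const_mem[of 0]] functional_zero[OF assms(1)] by simp
  next
    case False
    then show ?thesis
      using that assms(2) unfolding strictly_positive_def ae_le_def ae_eq_def by (meson less_imp_le)
  qed
  with assms(1) show ?thesis by (simp add: pos_order_dual_def)
qed

end

section \<open>Strictly positive extensions\<close>

context function_space_with_constants
begin

text \<open>Halmos--Savage exhaustion. Sets on which some admissible functional is strictly positive are
closed under countable unions, because weighted sums of functionals remain admissible; a maximal
such set has full measure.\<close>

lemma strictly_positive_exists:
  assumes sep: "\<And>x. x \<in> X \<Longrightarrow> AE \<omega> in P. 0 \<le> x \<omega> \<Longrightarrow> \<not> (AE \<omega> in P. x \<omega> = 0) \<Longrightarrow>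
      \<exists>\<phi>\<in>pos_order_dual P X. (\<forall>m\<in>S. \<phi> m = 0) \<and> 0 < \<phi> x"
  shows "\<exists>\<phi>\<in>pos_order_dual P X. (\<forall>m\<in>S. \<phi> m = 0) \<and> strictly_positive P X \<phi>"
proof -
  define Q where "Q = {\<phi> \<in> pos_order_dual P X. \<forall>m\<in>S. \<phi> m = 0}"
  define charges where "charges \<phi> A \<longleftrightarrow>
    (\<forall>B\<in>sets P. B \<subseteq> A \<longrightarrow> 0 < prob B \<longrightarrow> 0 < \<phi> (indicator B))" for \<phi> :: "('a \<Rightarrow> real) \<Rightarrow> real" and A
  define \<Z> where "\<Z> = {A \<in> sets P. \<exists>\<phi>\<in>Q. charges \<phi> A}"
  \<comment> \<open>Separation at the constant 1 gives one admissible functional. It charges the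
    empty set vacuously, so the family to be exhausted is nonempty.\<close>
  have "\<exists>\<phi>. \<phi> \<in> Q" using sep[OF const_mem[of 1]] by (auto simp: Q_def)
  then have "{} \<in> \<Z>" by (auto simp: \<Z>_def charges_def)
  have "(\<Union>n. A n) \<in> \<Z>" if A: "range A \<subseteq> \<Z>" for A :: "nat \<Rightarrow> 'a set"
  proof -
    have A_sets[measurable]: "A n \<in> sets P" for n using A by (auto simp: \<Z>_def)
    have "\<forall>n. \<exists>\<phi>\<in>Q. charges \<phi> (A n)" using A by (auto simp: \<Z>_def)
    then obtain \<phi> where Q: "\<And>n. \<phi> n \<in> Q" and ch: "\<And>n. charges (\<phi> n) (A n)" by metis
    have \<phi>: "\<phi> n \<in> pos_order_dual P X" for n using Q by (simp add: Q_def)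
    obtain c where c: "\<And>n. 0 < c n" "\<And>x. x \<in> X \<Longrightarrow> summable (\<lambda>n. c n * \<phi> n x)"
      "(\<lambda>x. \<Sum>n. c n * \<phi> n x) \<in> pos_order_dual P X"
      using pos_order_dual_countable_sum[of \<phi>, OF \<phi>] by blast
    have "(\<lambda>x. \<Sum>n. c n * \<phi> n x) \<in> Q" using c(3) Q by (simp add: Q_def)
    moreover have "charges (\<lambda>x. \<Sum>n. c n * \<phi> n x) (\<Union>n. A n)"
      unfolding charges_def
    proof (intro ballI impI)
      fix B assume B[measurable]: "B \<in> sets P" and sub: "B \<subseteq> (\<Union>n. A n)" and "0 < prob B"
      have "\<exists>n. 0 < prob (B \<inter> A n)"
      proof (rule ccontr)
        assume "\<not> ?thesis"
        then have "prob (B \<inter> A n) = 0" for n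
          by (simp add: not_less measure_le_0_iff)
        then have "B \<inter> A n \<in> null_sets P" for n by (simp add: null_sets_def emeasure_eq_measure)
        then have "(\<Union>n. B \<inter> A n) \<in> null_sets P" by blast
        moreover have "(\<Union>n. B \<inter> A n) = B" using sub by blast
        ultimately show False using \<open>0 < prob B\<close> by (simp add: null_sets_def measure_def)
      qed
      then obtain n where "0 < prob (B \<inter> A n)" by blast
      then have "0 < \<phi> n (indicator (B \<inter> A n))" using ch[of n] unfolding charges_def by auto
      also have "\<dots> \<le> \<phi> n (indicator B)" by (intro pos_order_dual_indicator_mono[OF \<phi>]) auto
      finally have "0 < c n * \<phi> n (indicator B)" using c(1) by simp
      moreover have "0 \<le> c k * \<phi> k (indicator B)" for k
        using c(1)[of k] by (intro mult_nonneg_nonneg pos_order_dual_nonneg[OF \<phi>] indicator_mem) auto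
      ultimately show "0 < (\<Sum>n. c n * \<phi> n (indicator B))"
        using suminf_pos2[OF c(2)[OF indicator_mem[OF B]]] by blast
    qed
    moreover have "(\<Union>n. A n) \<in> sets P" by measurable
    ultimately show ?thesis unfolding \<Z>_def by blast
  qed
  then obtain A where A: "A \<in> \<Z>" and A_max: "\<And>B. B \<in> \<Z> \<Longrightarrow> prob (B - A) = 0"
    using exhaustion[of \<Z>] \<open>{} \<in> \<Z>\<close> by (auto simp: \<Z>_def)
  have A_sets[measurable]: "A \<in> sets P" using A by (simp add: \<Z>_def)
  obtain \<phi> where "\<phi> \<in> Q" and ch: "charges \<phi> A" using A by (auto simp: \<Z>_def)
  then have \<phi>: "\<phi> \<in> pos_order_dual P X" by (simp add: Q_def)
  have "prob (space P - A) = 0"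
  proof (rule ccontr)
    assume nz: "prob (space P - A) \<noteq> 0"
    have "\<not> (AE \<omega> in P. indicator (space P - A) \<omega> = (0::real))"
    proof
      assume "AE \<omega> in P. indicator (space P - A) \<omega> = (0::real)"
      then have "AE \<omega> in P. \<omega> \<notin> space P - A" by eventually_elim (auto simp: indicator_def split: if_splits)
      then have "space P - A \<in> null_sets P" by (subst (asm) AE_iff_null_sets[symmetric]) auto
      with nz show False by (simp add: null_sets_def measure_def)
    qed
    then obtain \<psi> where "\<psi> \<in> Q" and \<psi>_pos: "0 < \<psi> (indicator (space P - A))"
      using sep[of "indicator (space P - A)"] by (auto simp: Q_def indicator_mem)
    then have \<psi>: "\<psi> \<in> pos_order_dual P X" by (simp add: Q_def)
    \<comment> \<open>\<psi> is positive on the complement of \<open>A\<close> as a whole but may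
      vanish on parts of it. A second exhaustion removes a maximal such part \<open>Z\<close>;
      \<psi> charges what remains.\<close>
    let ?N = "{Z \<in> sets P. \<psi> (indicator Z) = 0}"
    have "{} \<in> ?N" using pos_order_dual_null_set[OF \<psi>, of "{}"] by auto
    moreover have "(\<Union>n. Z n) \<in> ?N" if "range Z \<subseteq> ?N" for Z :: "nat \<Rightarrow> 'a set"
      using that pos_order_dual_null_UN[OF \<psi>, of Z] by auto
    ultimately obtain Z where Z: "Z \<in> ?N" and Z_max: "\<And>B. B \<in> ?N \<Longrightarrow> prob (B - Z) = 0"
      using exhaustion[of ?N] by (metis (no_types, lifting) empty_iff mem_Collect_eq subsetI)
    then have Z_sets[measurable]: "Z \<in> sets P" by simp
    define B where "B = space P - A - Z"
    have B_sets[measurable]: "B \<in> sets P" unfolding B_def by measurable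
    have "charges \<psi> B"
      unfolding charges_def
    proof (intro ballI impI)
      fix C assume C: "C \<in> sets P" "C \<subseteq> B" "0 < prob C"
      have "C - Z = C" using C(2) by (auto simp: B_def)
      then have "\<psi> (indicator C) \<noteq> 0" using Z_max[of C] C by auto
      moreover have "0 \<le> \<psi> (indicator C)"
        using C by (intro pos_order_dual_nonneg[OF \<psi>] indicator_mem) auto
      ultimately show "0 < \<psi> (indicator C)" by simp
    qed
    \<comment> \<open>\<open>B\<close> belongs to the family but misses \<open>A\<close>, so
      maximality makes it a null set. The complement of \<open>A\<close> is then covered by
      \<open>B\<close> and \<open>Z\<close>, on both of which \<psi> vanishes.\<close>
    with \<open>\<psi> \<in> Q\<close> have "B \<in> \<Z>" by (auto simp: \<Z>_def)
    moreover have "B - A = B" by (auto simp: B_def)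
    ultimately have "prob B = 0" using A_max[of B] by simp
    then have "\<psi> (indicator B) = 0" by (intro pos_order_dual_null_set[OF \<psi>]) auto
    then have "\<psi> (indicator (B \<union> Z)) \<le> 0"
      using pos_order_dual_indicator_Un[OF \<psi> B_sets Z_sets] Z by simp
    moreover have "\<psi> (indicator (space P - A)) \<le> \<psi> (indicator (B \<union> Z))"
      by (intro pos_order_dual_indicator_mono[OF \<psi>]) (auto simp: B_def)
    ultimately show False using \<psi>_pos by simp
  qed
  have "0 < \<phi> (indicator B)" if B[measurable]: "B \<in> sets P" and "0 < prob B" for B
  proof -
    have "prob (B - A) \<le> prob (space P - A)"
      using sets.sets_into_space[OF B] by (intro finite_measure_mono) auto
    then have "prob (B - A) = 0" using \<open>prob (space P - A) = 0\<close> measure_nonneg[of P "B - A"] by linarith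
    then have "0 < prob (B \<inter> A)"
      using finite_measure_Diff'[OF B A_sets] \<open>0 < prob B\<close> by simp
    then have "0 < \<phi> (indicator (B \<inter> A))" using ch unfolding charges_def by auto
    also have "\<dots> \<le> \<phi> (indicator B)" by (intro pos_order_dual_indicator_mono[OF \<phi>]) auto
    finally show ?thesis .
  qed
  then have "strictly_positive P X \<phi>" by (rule strictly_positiveI[OF \<phi>])
  with \<open>\<phi> \<in> Q\<close> show ?thesis by (auto simp: Q_def)
qed

text \<open>A point outside the weak closure is kept away from \<open>K\<close> by finitely many
  functionals. Evaluating them sends \<open>K\<close> to a cone in a finite-dimensional space, and
  the coefficients separating there define \<psi>.\<close>

lemma weak_closure_separation:
  assumes K: "K \<subseteq> X" "K \<noteq> {}"
    and add: "\<And>s t. s \<in> K \<Longrightarrow> t \<in> K \<Longrightarrow> (\<lambda>\<omega>. s \<omega> + t \<omega>) \<in> K"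
    and scale: "\<And>c s. 0 \<le> c \<Longrightarrow> s \<in> K \<Longrightarrow> (\<lambda>\<omega>. c * s \<omega>) \<in> K"
    and x: "x \<in> X" "x \<notin> weak_closure P X K"
  shows "\<exists>\<psi>\<in>order_cont_dual P X. 0 < \<psi> x \<and> (\<forall>k\<in>K. \<psi> k \<le> 0)"
proof -
  obtain \<Phi> e where \<Phi>: "finite \<Phi>" "\<Phi> \<subseteq> order_cont_dual P X" "0 < e"
    and far: "\<And>s. s \<in> K \<Longrightarrow> \<exists>\<phi>\<in>\<Phi>. e \<le> \<bar>\<phi> x - \<phi> s\<bar>"
    using x unfolding weak_closure_def by (auto simp: not_less)
  \<comment> \<open>Functionals outside \<open>\<Phi>\<close> need not be linear, so their coordinates are set to 0.\<close>
  define T where "T k \<phi> = (if \<phi> \<in> \<Phi> then \<phi> k else 0)" for k and \<phi> :: "('a \<Rightarrow> real) \<Rightarrow> real"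
  have "\<exists>a. 0 < (\<Sum>\<phi>\<in>\<Phi>. a \<phi> * T x \<phi>) \<and> (\<forall>s\<in>T ` K. (\<Sum>\<phi>\<in>\<Phi>. a \<phi> * s \<phi>) \<le> 0)"
  proof (rule cone_separation[OF \<Phi>(1) _ _ _ \<Phi>(3)])
    show "(\<lambda>\<phi>. s \<phi> + t \<phi>) \<in> T ` K" if st: "s \<in> T ` K" "t \<in> T ` K" for s t
    proof -
      obtain k l where kl: "k \<in> K" "l \<in> K" "s = T k" "t = T l" using st by blast
      have "(\<lambda>\<phi>. s \<phi> + t \<phi>) = T (\<lambda>\<omega>. k \<omega> + l \<omega>)"
        using kl K \<Phi>(2) by (auto simp: T_def fun_eq_iff functional_add subset_iff)
      then show ?thesis using add kl by blast
    qed
    show "(\<lambda>\<phi>. c * s \<phi>) \<in> T ` K" if c: "0 \<le> c" and s: "s \<in> T ` K" for c s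
    proof -
      obtain k where k: "k \<in> K" "s = T k" using s by blast
      have "(\<lambda>\<phi>. c * s \<phi>) = T (\<lambda>\<omega>. c * k \<omega>)"
        using k K \<Phi>(2) by (auto simp: T_def fun_eq_iff functional_scale subset_iff)
      then show ?thesis using scale[OF c] k by blast
    qed
    show "\<exists>\<phi>\<in>\<Phi>. e \<le> \<bar>T x \<phi> - s \<phi>\<bar>" if "s \<in> T ` K" for s
      using that far by (auto simp: T_def)
  qed (use K in auto)
  then obtain a where a: "0 < (\<Sum>\<phi>\<in>\<Phi>. a \<phi> * T x \<phi>)" "\<And>k. k \<in> K \<Longrightarrow> (\<Sum>\<phi>\<in>\<Phi>. a \<phi> * T k \<phi>) \<le> 0"
    by blast
  have "(\<Sum>\<phi>\<in>\<Phi>. a \<phi> * T k \<phi>) = (\<Sum>\<phi>\<in>\<Phi>. a \<phi> * \<phi> k)" for k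
    by (rule sum.cong) (auto simp: T_def)
  then show ?thesis
    using a order_cont_dual_sum[of \<Phi> "\<lambda>\<phi>. \<phi>" a] \<Phi>(2)
    by (intro bexI[of _ "\<lambda>x. \<Sum>\<phi>\<in>\<Phi>. a \<phi> * \<phi> x"]) auto
qed

lemma strictly_positive_extension:
  assumes M: "M \<subseteq> X" "(\<lambda>_. 1) \<in> M"
    and add: "\<And>x y. x \<in> M \<Longrightarrow> y \<in> M \<Longrightarrow> (\<lambda>\<omega>. x \<omega> + y \<omega>) \<in> M"
    and scale: "\<And>c x. x \<in> M \<Longrightarrow> (\<lambda>\<omega>. c * x \<omega>) \<in> M"
    and \<pi>: "positive_linear_on P M \<pi>" and nfl: "no_free_lunch P X M \<pi>"
  shows "\<exists>\<phi>\<in>order_cont_dual P X. strictly_positive P X \<phi> \<and> (\<forall>m\<in>M. \<phi> m = \<pi> m)"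
proof -
  define M0 where "M0 = {m\<in>M. \<pi> m = 0}"
  define K where "K = {(\<lambda>\<omega>. m \<omega> - y \<omega>) | m y. m \<in> M0 \<and> y \<in> X \<and> (AE \<omega> in P. 0 \<le> y \<omega>)}"
  have nfl': "AE \<omega> in P. x \<omega> = 0" if "x \<in> weak_closure P X K" "AE \<omega> in P. 0 \<le> x \<omega>" for x
    using nfl that unfolding no_free_lunch_def Let_def K_def M0_def ae_le_def ae_eq_def by blast
  have \<pi>_add: "\<And>x y. x \<in> M \<Longrightarrow> y \<in> M \<Longrightarrow> \<pi> (\<lambda>\<omega>. x \<omega> + y \<omega>) = \<pi> x + \<pi> y"
    and \<pi>_scale: "\<And>c x. x \<in> M \<Longrightarrow> \<pi> (\<lambda>\<omega>. c * x \<omega>) = c * \<pi> x"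
    and \<pi>_pos: "\<And>x. x \<in> M \<Longrightarrow> AE \<omega> in P. 0 \<le> x \<omega> \<Longrightarrow> 0 \<le> \<pi> x"
    using \<pi> unfolding positive_linear_on_def ae_le_def by blast+
  have M0_add: "(\<lambda>\<omega>. x \<omega> + y \<omega>) \<in> M0" if "x \<in> M0" "y \<in> M0" for x y
    using that by (auto simp: M0_def add \<pi>_add)
  have M0_scale: "(\<lambda>\<omega>. c * x \<omega>) \<in> M0" if "x \<in> M0" for c x
    using that by (auto simp: M0_def scale \<pi>_scale)
  have M0_zero: "(\<lambda>_. 0) \<in> M0"
    using scale[OF M(2), of 0] \<pi>_scale[OF M(2), of 0] by (simp add: M0_def)
  have K_I: "(\<lambda>\<omega>. m \<omega> - y \<omega>) \<in> K" if "m \<in> M0" "y \<in> X" "AE \<omega> in P. 0 \<le> y \<omega>" for m y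
    unfolding K_def using that by blast
  have M0_K: "m \<in> K" if "m \<in> M0" for m
    using K_I[OF that const_mem[of 0]] by simp
  have neg_K: "(\<lambda>\<omega>. - 1 * y \<omega>) \<in> K" if "y \<in> X" "AE \<omega> in P. 0 \<le> y \<omega>" for y
    using K_I[OF M0_zero that] by simp
  have K_X: "K \<subseteq> X" unfolding K_def M0_def using M(1) by (auto intro: diff_mem)
  have K_add: "(\<lambda>\<omega>. s \<omega> + t \<omega>) \<in> K" if st: "s \<in> K" "t \<in> K" for s t
  proof -
    obtain m y m' y' where *: "s = (\<lambda>\<omega>. m \<omega> - y \<omega>)" "t = (\<lambda>\<omega>. m' \<omega> - y' \<omega>)" "m \<in> M0" "m' \<in> M0"
      "y \<in> X" "y' \<in> X" "AE \<omega> in P. 0 \<le> y \<omega>" "AE \<omega> in P. 0 \<le> y' \<omega>"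
      using st unfolding K_def by blast
    have "AE \<omega> in P. 0 \<le> y \<omega> + y' \<omega>" using *(7,8) by eventually_elim simp
    from K_I[OF M0_add[OF *(3,4)] add_mem[OF *(5,6)] this] show ?thesis
      by (simp add: *(1,2) algebra_simps)
  qed
  have K_scale: "(\<lambda>\<omega>. c * s \<omega>) \<in> K" if c: "0 \<le> c" and s: "s \<in> K" for c s
  proof -
    obtain m y where *: "s = (\<lambda>\<omega>. m \<omega> - y \<omega>)" "m \<in> M0" "y \<in> X" "AE \<omega> in P. 0 \<le> y \<omega>"
      using s unfolding K_def by blast
    have "AE \<omega> in P. 0 \<le> c * y \<omega>" using *(4) by eventually_elim (simp add: c)
    from K_I[OF M0_scale[OF *(2)] scale_mem[OF *(3)] this] show ?thesis
      by (simp add: *(1) right_diff_distrib)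
  qed
  have not_AE: "\<not> (AE \<omega> in P. (1::real) = 0)" using AE_False by simp
  \<comment> \<open>If 1 had price 0, it would itself be a free lunch.\<close>
  have "\<pi> (\<lambda>_. 1) \<noteq> 0"
  proof
    assume "\<pi> (\<lambda>_. 1) = 0"
    then have "(\<lambda>_. 1) \<in> K" using M(2) by (intro M0_K) (simp add: M0_def)
    then have "(\<lambda>_. 1) \<in> weak_closure P X K" unfolding weak_closure_def using const_mem
      by (auto intro!: bexI[of _ "\<lambda>_. 1"])
    from nfl'[OF this] not_AE show False by simp
  qed
  with \<pi>_pos[OF M(2)] have \<pi>_1: "0 < \<pi> (\<lambda>_. 1)" by auto
  have "\<exists>\<phi>\<in>pos_order_dual P X. (\<forall>m\<in>M0. \<phi> m = 0) \<and> 0 < \<phi> x"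
    if x: "x \<in> X" "AE \<omega> in P. 0 \<le> x \<omega>" "\<not> (AE \<omega> in P. x \<omega> = 0)" for x
  proof -
    have "x \<notin> weak_closure P X K" using nfl' x by blast
    then obtain \<psi> where \<psi>: "\<psi> \<in> order_cont_dual P X" "0 < \<psi> x" "\<And>k. k \<in> K \<Longrightarrow> \<psi> k \<le> 0"
      using weak_closure_separation[OF K_X _ K_add K_scale x(1)] M0_K[OF M0_zero] by blast
    have "0 \<le> \<psi> y" if "y \<in> X" "AE \<omega> in P. 0 \<le> y \<omega>" for y
      \<comment> \<open>Positivity comes from -X_+ lying in \<open>K\<close>.\<close>
      using \<psi>(3)[OF neg_K[OF that]] functional_scale[OF \<psi>(1) that(1), of "- 1"] by simp
    then have "\<psi> \<in> pos_order_dual P X" using \<psi>(1) by (simp add: pos_order_dual_def)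
    moreover have "\<psi> m = 0" if "m \<in> M0" for m
    proof -
      have "m \<in> X" using that M(1) by (auto simp: M0_def)
      then show ?thesis
        using \<psi>(3)[OF M0_K[OF that]] \<psi>(3)[OF M0_K[OF M0_scale[OF that, of "- 1"]]]
          functional_scale[OF \<psi>(1), of m "- 1"] by simp
    qed
    ultimately show ?thesis using \<psi>(2) by blast
  qed
  then obtain \<phi> where "\<phi> \<in> pos_order_dual P X" and \<phi>0: "\<And>m. m \<in> M0 \<Longrightarrow> \<phi> m = 0"
    and sp: "strictly_positive P X \<phi>"
    using strictly_positive_exists[of M0] by blast
  then have \<phi>: "\<phi> \<in> order_cont_dual P X" by (simp add: pos_order_dual_def)
  have \<phi>_1: "0 < \<phi> (\<lambda>_. 1)"
    using sp not_AE const_mem[of 1] by (simp add: strictly_positive_def ae_le_def ae_eq_def)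
  define c where "c = \<pi> (\<lambda>_. 1) / \<phi> (\<lambda>_. 1)"
  have "0 < c" using \<pi>_1 \<phi>_1 by (simp add: c_def)
  have "(\<lambda>x. c * \<phi> x) \<in> order_cont_dual P X"
    using order_cont_dual_sum[of "{()}" "\<lambda>_. \<phi>" "\<lambda>_. c"] \<phi> by simp
  moreover have "strictly_positive P X (\<lambda>x. c * \<phi> x)"
    using sp \<open>0 < c\<close> by (simp add: strictly_positive_def)
  moreover have "c * \<phi> m = \<pi> m" if m: "m \<in> M" for m
  proof -
    \<comment> \<open>Adding this multiple of 1 brings the price of \<open>m\<close> to 0, so \<phi>
      vanishes on the result and its value at \<open>m\<close> is determined by its value at
      1.\<close>
    define q where "q = - (\<pi> m / \<pi> (\<lambda>_. 1))"
    have "(\<lambda>\<omega>. m \<omega> + q * 1) \<in> M0"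
      using add[OF m scale[OF M(2), of q]] \<pi>_add[OF m scale[OF M(2), of q]] \<pi>_scale[OF M(2), of q] \<pi>_1
      by (simp add: M0_def q_def)
    from \<phi>0[OF this] have "\<phi> m + q * \<phi> (\<lambda>_. 1) = 0"
      using functional_add[OF \<phi>, of m "\<lambda>_. q * 1"] functional_scale[OF \<phi> const_mem[of 1], of q]
        const_mem[of q] m M(1) by auto
    then have "\<phi> m = \<pi> m / \<pi> (\<lambda>_. 1) * \<phi> (\<lambda>_. 1)" by (simp add: q_def)
    then show ?thesis using \<pi>_1 \<phi>_1 by (simp add: c_def)
  qed
  ultimately show ?thesis by (intro bexI[of _ "\<lambda>x. c * \<phi> x"]) auto
qed

end

section \<open>Functionals determined by option prices\<close>

lemma option_spaceI: "(\<lambda>\<omega>. c + (\<Sum>i<n. a i * max (f \<omega> - k i) 0)) \<in> option_space f" for n :: nat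
  unfolding option_space_def by blast

lemma option_spaceE:
  assumes "x \<in> option_space f"
  obtains c a k and n :: nat where "x = (\<lambda>\<omega>. c + (\<Sum>i<n. a i * max (f \<omega> - k i) 0))"
  using assms unfolding option_space_def by blast

lemma option_space_add:
  assumes "x \<in> option_space f" "y \<in> option_space f"
  shows "(\<lambda>\<omega>. x \<omega> + y \<omega>) \<in> option_space f"
proof -
  obtain c a k and n :: nat where x: "x = (\<lambda>\<omega>. c + (\<Sum>i<n. a i * max (f \<omega> - k i) 0))"
    using assms(1) by (rule option_spaceE)
  obtain d b l and m :: nat where y: "y = (\<lambda>\<omega>. d + (\<Sum>i<m. b i * max (f \<omega> - l i) 0))"
    using assms(2) by (rule option_spaceE)
  \<comment> \<open>The two lists of coefficients and strikes are concatenated, the second one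
    shifted by \<open>n\<close>.\<close>
  define a' where "a' i = (if i < n then a i else b (i - n))" for i
  define k' where "k' i = (if i < n then k i else l (i - n))" for i
  have "(\<Sum>i<n + m. a' i * max (f \<omega> - k' i) 0) =
      (\<Sum>i<n. a i * max (f \<omega> - k i) 0) + (\<Sum>i<m. b i * max (f \<omega> - l i) 0)" for \<omega>
    by (induction m) (auto simp: a'_def k'_def intro!: sum.cong)
  then have "(\<lambda>\<omega>. x \<omega> + y \<omega>) = (\<lambda>\<omega>. (c + d) + (\<Sum>i<n + m. a' i * max (f \<omega> - k' i) 0))"
    by (simp add: x y fun_eq_iff)
  then show ?thesis by (simp only: option_spaceI)
qed

lemma option_space_scale:
  assumes "x \<in> option_space f"
  shows "(\<lambda>\<omega>. r * x \<omega>) \<in> option_space f"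
proof -
  obtain c a k and n :: nat where x: "x = (\<lambda>\<omega>. c + (\<Sum>i<n. a i * max (f \<omega> - k i) 0))"
    using assms by (rule option_spaceE)
  have "(\<lambda>\<omega>. r * x \<omega>) = (\<lambda>\<omega>. r * c + (\<Sum>i<n. (r * a i) * max (f \<omega> - k i) 0))"
    by (simp add: x distrib_left sum_distrib_left mult.assoc)
  then show ?thesis by (simp only: option_spaceI)
qed

lemma option_space_one: "(\<lambda>_. 1) \<in> option_space f"
  using option_spaceI[of 1 _ _ _ 0] by simp

lemma option_space_call: "(\<lambda>\<omega>. max (f \<omega> - k) 0) \<in> option_space f"
  using option_spaceI[of 0 "\<lambda>_. 1" f "\<lambda>_. k" "Suc 0"] by simp

lemma
  assumes f: "f \<in> borel_measurable P"
  shows space_sigma_of: "space (sigma_of P f) = space P"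
    and sets_sigma_of: "sets (sigma_of P f) =
      sigma_sets (space P) ({f -` B \<inter> space P | B. B \<in> sets borel} \<union> null_sets P)"
    and sets_sigma_of_subset: "sets (sigma_of P f) \<subseteq> sets P"
proof -
  let ?G = "{f -` B \<inter> space P | B. B \<in> sets borel} \<union> null_sets P"
  have G: "?G \<subseteq> sets P" using measurable_sets[OF f] by auto
  then have G': "?G \<subseteq> Pow (space P)" using sets.space_closed by blast
  show "space (sigma_of P f) = space P"
    unfolding sigma_of_def using G' by (rule space_measure_of)
  show eq: "sets (sigma_of P f) = sigma_sets (space P) ?G"
    unfolding sigma_of_def using G' by (rule sets_measure_of)
  show "sets (sigma_of P f) \<subseteq> sets P"
    unfolding eq using G by (rule sets.sigma_sets_subset)
qed

text \<open>Sets that agree a.e. with a preimage under f are closed under complements and countable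
  unions and include the null sets. Functionals do not see a.e. changes, so preimages are enough
  later.\<close>

lemma sets_sigma_of_AE_vimage:
  assumes f: "f \<in> borel_measurable P" and A: "A \<in> sets (sigma_of P f)"
  shows "\<exists>B\<in>sets borel. AE \<omega> in P. \<omega> \<in> A \<longleftrightarrow> f \<omega> \<in> B"
  using A unfolding sets_sigma_of[OF f]
proof (induction rule: sigma_sets.induct)
  case (Basic A)
  then show ?case
  proof
    assume "A \<in> null_sets P"
    then have "AE \<omega> in P. \<omega> \<notin> A" by (rule AE_not_in)
    then show ?thesis by (intro bexI[of _ "{}"]) auto
  qed auto
next
  case Empty
  then show ?case by (intro bexI[of _ "{}"]) auto
next
  case (Compl A)
  then obtain B where B: "B \<in> sets borel" "AE \<omega> in P. \<omega> \<in> A \<longleftrightarrow> f \<omega> \<in> B" by blast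
  have "AE \<omega> in P. \<omega> \<in> space P - A \<longleftrightarrow> f \<omega> \<in> - B"
    using B(2) AE_space by eventually_elim auto
  with B(1) show ?case by (intro bexI[of _ "- B"]) auto
next
  case (Union A)
  then obtain B where B: "\<And>i. B i \<in> sets borel" "\<And>i. AE \<omega> in P. \<omega> \<in> A i \<longleftrightarrow> f \<omega> \<in> B i" by metis
  have "AE \<omega> in P. \<forall>i. \<omega> \<in> A i \<longleftrightarrow> f \<omega> \<in> B i" using B(2) by (subst AE_all_countable) auto
  then have "AE \<omega> in P. \<omega> \<in> (\<Union>i. A i) \<longleftrightarrow> f \<omega> \<in> (\<Union>i. B i)" by eventually_elim auto
  with B(1) show ?case by (intro bexI[of _ "\<Union>i. B i"]) auto
qed

context function_space_with_constants
begin

lemma option_space_subset: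
  assumes "f \<in> X"
  shows "option_space f \<subseteq> X"
proof
  fix x assume "x \<in> option_space f"
  then obtain c a k and n :: nat where "x = (\<lambda>\<omega>. c + (\<Sum>i<n. a i * max (f \<omega> - k i) 0))"
    by (rule option_spaceE)
  then show "x \<in> X"
    using assms by (auto intro!: add_mem const_mem sum_mem scale_mem max_zero_mem diff_mem)
qed

text \<open>The scaled call spreads \<open>n ((f - k)\<^sup>+ - (f - k - 1/n)\<^sup>+)\<close> increase to the indicator of
\<open>{f > k}\<close>.\<close>

lemma indicator_gt_eq:
  assumes \<phi>: "\<phi> \<in> pos_order_dual P X" and \<psi>: "\<psi> \<in> pos_order_dual P X" and f: "f \<in> X"
    and agree: "\<And>m. m \<in> option_space f \<Longrightarrow> \<phi> m = \<psi> m"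
  shows "\<phi> (indicator (f -` {k<..} \<inter> space P)) = \<psi> (indicator (f -` {k<..} \<inter> space P))"
proof -
  define A where "A = f -` {k<..} \<inter> space P"
  have A: "A \<in> sets P" unfolding A_def using measurable_mem[OF f] by (rule measurable_sets) simp
  \<comment> \<open>In this truncated form monotonicity and the limit are evident;
    \<open>u_eq\<close> recovers the call spread and with it membership in the option space.\<close>
  define u where "u n \<omega> = min 1 (real (Suc n) * max (f \<omega> - k) 0)" for n \<omega>
  have u_eq: "u n = (\<lambda>\<omega>. real (Suc n) * (max (f \<omega> - k) 0 + (- 1) * max (f \<omega> - (k + 1 / real (Suc n))) 0))" for n
  proof
    fix \<omega>
    \<comment> \<open>Locally \<open>N\<close> is the slope of the spread and shadows the norm. The
      identity is piecewise linear in \<open>t\<close> with breakpoints 0 and 1/N.\<close>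
    define N where "N = real (Suc n)"
    have "0 < N" by (simp add: N_def)
    define t where "t = f \<omega> - k"
    have "min 1 (N * max t 0) = N * (max t 0 + (- 1) * max (t - 1 / N) 0)"
      using \<open>0 < N\<close> mult_nonneg_nonpos[of N t]
      by (cases "t \<le> 0"; cases "t \<le> 1 / N") (auto simp: max_def min_def field_simps)
    then show "u n \<omega> = real (Suc n) * (max (f \<omega> - k) 0 + (- 1) * max (f \<omega> - (k + 1 / real (Suc n))) 0)"
      by (simp add: u_def t_def N_def diff_diff_eq)
  qed
  have u: "u n \<in> option_space f" for n
    unfolding u_eq by (intro option_space_scale option_space_add option_space_call)
  have inc: "incseq (\<lambda>n. u n \<omega>)" for \<omega>
    unfolding incseq_def u_def by (intro allI impI min.mono mult_right_mono) auto
  have lim: "(\<lambda>n. u n \<omega>) \<longlonglongrightarrow> indicator A \<omega>" if "\<omega> \<in> space P" for \<omega>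
  proof (cases "f \<omega> > k")
    case True
    then obtain m where m: "1 / real (Suc m) < f \<omega> - k" using nat_approx_posE[of "f \<omega> - k"] by auto
    have "u n \<omega> = 1" if "m \<le> n" for n
    proof -
      have "1 \<le> real (Suc m) * (f \<omega> - k)" using m by (simp add: field_simps)
      also have "\<dots> \<le> real (Suc n) * (f \<omega> - k)" using that True by (intro mult_right_mono) auto
      finally show ?thesis using True by (simp add: u_def)
    qed
    then have "eventually (\<lambda>n. u n \<omega> = 1) sequentially" by (auto simp: eventually_sequentially)
    then show ?thesis using True \<open>\<omega> \<in> space P\<close> by (simp add: A_def tendsto_eventually)
  qed (auto simp: u_def A_def)
  have conv: "(\<lambda>n. \<theta> (u n)) \<longlonglongrightarrow> \<theta> (indicator A)" if \<theta>: "\<theta> \<in> pos_order_dual P X" for \<theta>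
    using u option_space_subset[OF f] inc lim
    by (intro pos_order_dual_incseq[OF \<theta>] indicator_mem A AE_I2) auto
  have "(\<lambda>n. \<phi> (u n)) \<longlonglongrightarrow> \<psi> (indicator A)" using conv[OF \<psi>] agree[OF u] by simp
  then show ?thesis using conv[OF \<phi>] LIMSEQ_unique unfolding A_def by blast
qed

text \<open>Open half-lines are stable under intersection and generate the Borel sets. Complements
  are covered because 1 belongs to the option space, so both functionals have the same total mass;
  disjoint unions follow from additivity and monotone limits.\<close>

lemma indicator_vimage_eq:
  assumes \<phi>: "\<phi> \<in> pos_order_dual P X" and \<psi>: "\<psi> \<in> pos_order_dual P X" and f: "f \<in> X"
    and agree: "\<And>m. m \<in> option_space f \<Longrightarrow> \<phi> m = \<psi> m" and B: "B \<in> sets borel"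
  shows "\<phi> (indicator (f -` B \<inter> space P)) = \<psi> (indicator (f -` B \<inter> space P))"
proof -
  let ?V = "\<lambda>B. f -` B \<inter> space P"
  note \<phi>' = pos_order_dual_order_cont[OF \<phi>] and \<psi>' = pos_order_dual_order_cont[OF \<psi>]
  have sets_borel: "sets borel = sigma_sets UNIV (range (greaterThan :: real \<Rightarrow> real set))"
    by (subst borel_Ioi) simp
  have V: "?V B \<in> sets P" if "B \<in> sigma_sets UNIV (range (greaterThan :: real \<Rightarrow> real set))" for B
    using measurable_sets[OF measurable_mem[OF f]] that unfolding sets_borel[symmetric] by blast
  have Int: "Int_stable (range (greaterThan :: real \<Rightarrow> real set))"
    by (auto simp: Int_stable_def lessThan_Int_lessThan)
  have subset_Pow_UNIV: "range (greaterThan :: real \<Rightarrow> real set) \<subseteq> Pow UNIV" by simp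
  from B[unfolded sets_borel] show ?thesis
  proof (induction rule: sigma_sets_induct_disjoint[OF Int subset_Pow_UNIV, consumes 1,
        case_names basic empty compl union])
    case (basic B)
    then show ?case using indicator_gt_eq[OF \<phi> \<psi> f agree] by auto
  next
    case empty
    have "indicator (?V {}) = (\<lambda>_. 0 :: real)" by (simp add: fun_eq_iff)
    then show ?case by (simp only: functional_zero[OF \<phi>'] functional_zero[OF \<psi>'])
  next
    case (compl B)
    have "\<theta> (indicator (?V (UNIV - B))) = \<theta> (\<lambda>_. 1) - \<theta> (indicator (?V B))"
      if \<theta>: "\<theta> \<in> order_cont_dual P X" for \<theta>
    proof -
      have "UNIV - B \<in> sigma_sets UNIV (range greaterThan)" using compl(1) by (rule sigma_sets.Compl)
      then have "\<theta> (indicator (?V (UNIV - B))) = \<theta> (\<lambda>\<omega>. 1 - indicator (?V B) \<omega>)"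
        using compl(1)
        by (intro functional_cong[OF \<theta>] indicator_mem V diff_mem const_mem AE_I2) (auto simp: indicator_def)
      then show ?thesis using functional_diff[OF \<theta> const_mem[of 1] indicator_mem[OF V[OF compl(1)]]] by simp
    qed
    from this[OF \<phi>'] this[OF \<psi>'] show ?case using compl(2) agree[OF option_space_one] by argo
  next
    case (union B)
    have VB: "?V (B i) \<in> sets P" for i using union(2) by (intro V) auto
    have conv: "(\<lambda>n. \<Sum>i<n. \<theta> (indicator (?V (B i)))) \<longlonglongrightarrow> \<theta> (indicator (?V (\<Union>i. B i)))"
      if \<theta>: "\<theta> \<in> pos_order_dual P X" for \<theta>
    proof -
      have UN: "(\<Union>i<n. ?V (B i)) \<in> sets P" for n using VB by blast
      have "(\<lambda>n. \<theta> (indicator (\<Union>i<n. ?V (B i)))) \<longlonglongrightarrow> \<theta> (indicator (\<Union>n. \<Union>i<n. ?V (B i)))"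
        by (rule pos_order_dual_indicator_incseq[OF \<theta> UN]) (auto simp: incseq_def intro: less_le_trans)
      moreover have "(\<Union>n. \<Union>i<n. ?V (B i)) = ?V (\<Union>i. B i)" by blast
      moreover have "\<theta> (indicator (\<Union>i<n. ?V (B i))) = (\<Sum>i<n. \<theta> (indicator (?V (B i))))" for n
      proof -
        have "disjoint_family_on (\<lambda>i. ?V (B i)) {..<n}"
          using union(1) unfolding disjoint_family_on_def by blast
        then have "indicator (\<Union>i<n. ?V (B i)) = (\<lambda>\<omega>. \<Sum>i<n. indicator (?V (B i)) \<omega> :: real)"
          by (intro ext indicator_UN_disjoint finite_lessThan)
        then show ?thesis
          using functional_sum[OF pos_order_dual_order_cont[OF \<theta>], of "{..<n}" "\<lambda>i. indicator (?V (B i))"] VB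
          by (simp add: indicator_mem)
      qed
      ultimately show ?thesis by simp
    qed
    have "(\<lambda>n. \<Sum>i<n. \<phi> (indicator (?V (B i)))) \<longlonglongrightarrow> \<psi> (indicator (?V (\<Union>i. B i)))"
      using conv[OF \<psi>] union(3) by simp
    then show ?case using conv[OF \<phi>] LIMSEQ_unique by blast
  qed
qed

lemma functional_unique_sigma_of:
  assumes \<phi>: "\<phi> \<in> pos_order_dual P X" and \<psi>: "\<psi> \<in> pos_order_dual P X" and f: "f \<in> X"
    and agree: "\<And>m. m \<in> option_space f \<Longrightarrow> \<phi> m = \<psi> m"
    and g: "g \<in> X" "g \<in> borel_measurable (sigma_of P f)"
  shows "\<phi> g = \<psi> g"
proof -
  note \<phi>' = pos_order_dual_order_cont[OF \<phi>] and \<psi>' = pos_order_dual_order_cont[OF \<psi>]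
  note f' = measurable_mem[OF f]
  have sub: "u \<in> borel_measurable P" if "u \<in> borel_measurable (sigma_of P f)" for u :: "'a \<Rightarrow> real"
    using that sets_sigma_of_subset[OF f'] space_sigma_of[OF f'] by (auto simp: measurable_def)
  \<comment> \<open>Membership in X is part of the induction formula, since the induction rule
    passes through measurable functions that may lie outside X. Summands and approximants are
    dominated by the function at hand, so the ideal property brings them back into X.\<close>
  have nonneg: "u \<in> X \<longrightarrow> \<phi> u = \<psi> u"
    if "u \<in> borel_measurable (sigma_of P f)" "\<And>\<omega>. 0 \<le> u \<omega>" for u
    using that
  proof (induction rule: borel_measurable_induct_real)
    case (set A)
    then have A: "A \<in> sets P" using sets_sigma_of_subset[OF f'] by blast
    obtain B where B: "B \<in> sets borel" "AE \<omega> in P. \<omega> \<in> A \<longleftrightarrow> f \<omega> \<in> B"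
      using sets_sigma_of_AE_vimage[OF f' set] by blast
    let ?V = "f -` B \<inter> space P"
    have V: "?V \<in> sets P" using measurable_sets[OF f' B(1)] .
    have "AE \<omega> in P. indicator A \<omega> = (indicator ?V \<omega> :: real)"
      using B(2) AE_space by eventually_elim (simp add: indicator_def)
    then have "\<theta> (indicator A) = \<theta> (indicator ?V)" if "\<theta> \<in> order_cont_dual P X" for \<theta>
      using A V by (intro functional_cong[OF that] indicator_mem)
    from this[OF \<phi>'] this[OF \<psi>'] show ?case
      using indicator_vimage_eq[of \<phi> \<psi> f, OF \<phi> \<psi> f agree B(1)] by simp
  next
    case (mult u c)
    show ?case
    \<comment> \<open>For c = 0 the product lies in X whatever \<open>u\<close> is, so
      \<open>u\<close> cannot be recovered by dividing.\<close>
    proof (cases "c = 0")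
      case True
      then show ?thesis using functional_zero[OF \<phi>'] functional_zero[OF \<psi>'] by simp
    next
      case False
      show ?thesis
      proof
        assume "(\<lambda>\<omega>. c * u \<omega>) \<in> X"
        from scale_mem[OF this, of "1 / c"] have u: "u \<in> X" using False by simp
        with mult.IH show "\<phi> (\<lambda>\<omega>. c * u \<omega>) = \<psi> (\<lambda>\<omega>. c * u \<omega>)"
          by (simp add: functional_scale[OF \<phi>' u] functional_scale[OF \<psi>' u])
      qed
    qed
  next
    case (add u v)
    show ?case
    proof
      assume vu: "(\<lambda>\<omega>. v \<omega> + u \<omega>) \<in> X"
      have u: "u \<in> X" and v: "v \<in> X"
        using add.hyps(2,4)
        by (auto intro: ideal_mem[OF sub[OF add.hyps(1)] vu] ideal_mem[OF sub[OF add.hyps(3)] vu])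
      with add.IH show "\<phi> (\<lambda>\<omega>. v \<omega> + u \<omega>) = \<psi> (\<lambda>\<omega>. v \<omega> + u \<omega>)"
        by (simp add: functional_add[OF \<phi>' v u] functional_add[OF \<psi>' v u])
    qed
  next
    case (seq U)
    show ?case
    proof
      assume u: "u \<in> X"
      have inc: "incseq (\<lambda>n. U n \<omega>)" for \<omega> using seq.hyps(3) by (auto simp: incseq_def le_fun_def)
      have lim: "(\<lambda>n. U n \<omega>) \<longlonglongrightarrow> u \<omega>" if "\<omega> \<in> space P" for \<omega>
        using seq.hyps(4) that by (simp add: space_sigma_of[OF f'])
      have U: "U n \<in> X" for n
      proof (rule ideal_mem[OF sub[OF seq.hyps(1)] u], rule AE_I2)
        fix \<omega> assume "\<omega> \<in> space P"
        then have "U n \<omega> \<le> u \<omega>" using incseq_le[OF inc lim] by simp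
        then show "\<bar>U n \<omega>\<bar> \<le> \<bar>u \<omega>\<bar>" using seq.hyps(2)[of n \<omega>] by simp
      qed
      have "(\<lambda>n. \<theta> (U n)) \<longlonglongrightarrow> \<theta> u" if "\<theta> \<in> pos_order_dual P X" for \<theta>
        using inc lim by (intro pos_order_dual_incseq[OF that U u] AE_I2)
      from this[OF \<phi>] this[OF \<psi>] show "\<phi> u = \<psi> u"
        using seq.IH U LIMSEQ_unique[of "\<lambda>n. \<phi> (U n)"] by simp
    qed
  qed
  let ?p = "\<lambda>\<omega>. max (g \<omega>) 0" and ?n = "\<lambda>\<omega>. max (- 1 * g \<omega>) 0"
  have pn: "?p \<in> X" "?n \<in> X" by (intro max_zero_mem scale_mem g)+
  have "\<phi> ?p = \<psi> ?p" "\<phi> ?n = \<psi> ?n"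
    using nonneg[of ?p] nonneg[of ?n] g(2) pn by auto
  then have "\<phi> (\<lambda>\<omega>. ?p \<omega> - ?n \<omega>) = \<psi> (\<lambda>\<omega>. ?p \<omega> - ?n \<omega>)"
    by (simp only: functional_diff[OF \<phi>' pn] functional_diff[OF \<psi>' pn])
  moreover have "(\<lambda>\<omega>. ?p \<omega> - ?n \<omega>) = g" by (auto simp: fun_eq_iff max_def)
  ultimately show ?thesis by (simp only:)
qed

end

theorem theorem3p4:
  fixes P :: "'a measure" and X :: "('a \<Rightarrow> real) set" and N :: "('a \<Rightarrow> real) \<Rightarrow> real"
    and f :: "'a \<Rightarrow> real" and \<pi> :: "('a \<Rightarrow> real) \<Rightarrow> real"
  assumes "prob_space P"
    and "banach_function_space P X N"
    and "\<forall>c. (\<lambda>_. c) \<in> X"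
    and "f \<in> X" and "ae_le P (\<lambda>_. 0) f"
    and "positive_linear_on P (option_space f) \<pi>"
    and "no_free_lunch P X (option_space f) \<pi>"
  shows "\<forall>g\<in>X. g \<in> borel_measurable (sigma_of P f) \<longrightarrow>
           price_determined_by_arbitrage P X (option_space f) \<pi> g"
proof (intro ballI impI)
  interpret prob_space P by fact
  interpret function_space_with_constants P X N
    by unfold_locales (use assms in auto)
  fix g assume g: "g \<in> X" "g \<in> borel_measurable (sigma_of P f)"
  obtain \<phi> where \<phi>: "\<phi> \<in> order_cont_dual P X" "strictly_positive P X \<phi>"
    "\<And>m. m \<in> option_space f \<Longrightarrow> \<phi> m = \<pi> m"
    using strictly_positive_extension[OF option_space_subset[OF assms(4)] option_space_one
        option_space_add option_space_scale assms(6,7)] by blast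
  show "price_determined_by_arbitrage P X (option_space f) \<pi> g"
    unfolding price_determined_by_arbitrage_def
  proof (rule ex1I[of _ "\<phi> g"])
    show "consistent_price P X (option_space f) \<pi> g (\<phi> g)"
      using \<phi> unfolding consistent_price_def by blast
    fix p assume "consistent_price P X (option_space f) \<pi> g p"
    then obtain \<psi> where \<psi>: "\<psi> \<in> order_cont_dual P X" "strictly_positive P X \<psi>"
      "\<And>m. m \<in> option_space f \<Longrightarrow> \<psi> m = \<pi> m" "\<psi> g = p"
      unfolding consistent_price_def by blast
    \<comment> \<open>Both extensions are positive and equal \<pi> on the option space, hence agree
      there with each other.\<close>
    have "\<psi> g = \<phi> g"
      by (rule functional_unique_sigma_of[OF pos_order_dual_strictly_positive[OF \<psi>(1,2)]
            pos_order_dual_strictly_positive[OF \<phi>(1,2)] assms(4) _ g]) (simp add: \<phi>(3) \<psi>(3))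
    with \<psi>(4) show "p = \<phi> g" by simp
  qed
qed

end
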